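(* Let $k$ be an uncountable field and let $R$ be a finite dimensional $k$-algebra (commutative) of finite Ext-index. Let $k(x)$ be a purely transcendental extension of $k$ in one variable $x$. Then $R\otimes_k k(x)$ is of finite Ext-index; more precisely, $\mathrm{Ext}\text{-}\mathrm{index}(R\otimes_k k(x))\leq \mathrm{Ext}\text{-}\mathrm{index}(R)$.
   Context: All rings are commutative Noetherian with unity. For a ring $A$ and nonzero $A$-modules $M,N$, set $p^A(M,N)=\sup\{i\in\mathbb{N} : \mathrm{Ext}^i_A(M,N)\neq 0\}\ (\leq\infty)$. The Ext-index of $A$ is $\mathrm{Ext}\text{-}\mathrm{index}(A)=\sup\{p^A(M,N) : M,N \text{ finitely generated } A\text{-modules with } p^A(M,N)<\infty\}$, and $A$ is of finite Ext-index if $\mathrm{Ext}\text{-}\mathrm{index}(A)<\infty$. *)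

theory Defs
  imports "HOL-Computational_Algebra.Polynomial" "HOL-Computational_Algebra.Fraction_Field"
    "HOL-Library.Extended_Nat" "HOL-Library.Countable_Set"
begin

definition is_ring_hom :: "('a::comm_ring_1 \<Rightarrow> 'b::comm_ring_1) \<Rightarrow> bool" where
  "is_ring_hom h \<longleftrightarrow> h 1 = 1 \<and> (\<forall>x y. h (x + y) = h x + h y) \<and> (\<forall>x y. h (x * y) = h x * h y)"

text \<open>A vector of A^n is a function nat => A (only indices < n matter);
  an m x n matrix is a function nat => nat => A (only indices i < m, j < n matter).\<close>

definition mmul :: "nat \<Rightarrow> (nat \<Rightarrow> nat \<Rightarrow> 'a::comm_ring_1) \<Rightarrow> (nat \<Rightarrow> nat \<Rightarrow> 'a) \<Rightarrow> nat \<Rightarrow> nat \<Rightarrow> 'a" where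
  "mmul m X Y = (\<lambda>i j. \<Sum>l<m. X i l * Y l j)"

definition in_colspan :: "nat \<Rightarrow> nat \<Rightarrow> (nat \<Rightarrow> nat \<Rightarrow> 'a::comm_ring_1) \<Rightarrow> (nat \<Rightarrow> 'a) \<Rightarrow> bool" where
  "in_colspan p q P v \<longleftrightarrow> (\<exists>c. \<forall>i<p. v i = (\<Sum>l<q. P i l * c l))"

definition coker_nonzero :: "nat \<Rightarrow> nat \<Rightarrow> (nat \<Rightarrow> nat \<Rightarrow> 'a::comm_ring_1) \<Rightarrow> bool" where
  "coker_nonzero p q P \<longleftrightarrow> (\<exists>v. \<not> in_colspan p q P v)"

text \<open>A free resolution (with finite ranks) of M = coker(D 0):
  ... -> A^(n 2) --D 1--> A^(n 1) --D 0--> A^(n 0) -> M -> 0,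
  where D j is an (n j) x (n (j+1)) matrix; the complex is exact at every A^(n (j+1)).\<close>
definition free_resolution :: "(nat \<Rightarrow> nat) \<Rightarrow> (nat \<Rightarrow> nat \<Rightarrow> nat \<Rightarrow> 'a::comm_ring_1) \<Rightarrow> bool" where
  "free_resolution n D \<longleftrightarrow>
     (\<forall>j. \<forall>i<n j. \<forall>l<n (Suc (Suc j)). mmul (n (Suc j)) (D j) (D (Suc j)) i l = 0) \<and>
     (\<forall>j v. (\<forall>i<n j. (\<Sum>l<n (Suc j). D j i l * v l) = 0) \<longrightarrow>
            in_colspan (n (Suc j)) (n (Suc (Suc j))) (D (Suc j)) v)"

text \<open>Ext^i_A(M,N) \<noteq> 0 computed from the free resolution (n,D) of M, with
  N = coker(P : A^q -> A^p).  Hom(A^(n j), N) = N^(n j) is represented by p x (n j)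
  matrices Y modulo those whose columns all lie in the image of P; the coboundary
  map is Y |-> Y * D j.\<close>
definition ext_nonzero_res ::
  "(nat \<Rightarrow> nat) \<Rightarrow> (nat \<Rightarrow> nat \<Rightarrow> nat \<Rightarrow> 'a::comm_ring_1) \<Rightarrow> nat \<Rightarrow> nat \<Rightarrow> (nat \<Rightarrow> nat \<Rightarrow> 'a) \<Rightarrow> nat \<Rightarrow> bool" where
  "ext_nonzero_res n D p q P i \<longleftrightarrow>
     (\<exists>Y. (\<forall>l<n (Suc i). in_colspan p q P (\<lambda>r. mmul (n i) Y (D i) r l)) \<and>
          (case i of
             0 \<Rightarrow> \<not> (\<forall>m<n 0. in_colspan p q P (\<lambda>r. Y r m))
           | Suc j \<Rightarrow> \<not> (\<exists>Z. \<forall>m<n i. in_colspan p q P (\<lambda>r. Y r m - mmul (n j) Z (D j) r m))))"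

text \<open>Ext^i_A(M,N) \<noteq> 0 for M = coker(D0 : A^n1 -> A^n0) and N = coker(P : A^q -> A^p).
  (Ext does not depend on the chosen free resolution; we quantify over all of them.)\<close>
definition ext_nonzero ::
  "nat \<Rightarrow> nat \<Rightarrow> (nat \<Rightarrow> nat \<Rightarrow> 'a::comm_ring_1) \<Rightarrow> nat \<Rightarrow> nat \<Rightarrow> (nat \<Rightarrow> nat \<Rightarrow> 'a) \<Rightarrow> nat \<Rightarrow> bool" where
  "ext_nonzero n0 n1 D0 p q P i \<longleftrightarrow>
     (\<forall>n D. free_resolution n D \<and> n 0 = n0 \<and> n 1 = n1 \<and> D 0 = D0 \<longrightarrow> ext_nonzero_res n D p q P i)"

text \<open>Ext-index(A) = sup { p^A(M,N) : M, N nonzero f.g. with p^A(M,N) < \<infinity> }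
  = sup { i : Ext^i(M,N) \<noteq> 0 for some nonzero f.g. M, N with only finitely many
  nonvanishing Ext^j(M,N) }.  Finitely generated modules over a Noetherian ring are
  finitely presented, i.e. (up to isomorphism) cokernels of matrices.\<close>
definition ext_index :: "'a::comm_ring_1 itself \<Rightarrow> enat" where
  "ext_index (_ :: 'a itself) = Sup (enat ` {i. \<exists>n0 n1 (D0 :: nat \<Rightarrow> nat \<Rightarrow> 'a) p q P.
      coker_nonzero n0 n1 D0 \<and> coker_nonzero p q P \<and>
      ext_nonzero n0 n1 D0 p q P i \<and> finite {j. ext_nonzero n0 n1 D0 p q P j}})"

definition is_k_basis :: "('k::field \<Rightarrow> 'r::comm_ring_1) \<Rightarrow> 'r list \<Rightarrow> bool" where
  "is_k_basis \<iota> b \<longleftrightarrow> (\<forall>r. \<exists>!cs. length cs = length b \<and> r = (\<Sum>i<length b. \<iota> (cs ! i) * b ! i))"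

definition finite_dim_algebra :: "('k::field \<Rightarrow> 'r::comm_ring_1) \<Rightarrow> bool" where
  "finite_dim_algebra \<iota> \<longleftrightarrow> is_ring_hom \<iota> \<and> (\<exists>b. is_k_basis \<iota> b)"

definition const_kx :: "'k::field \<Rightarrow> 'k poly fract" where
  "const_kx c = Fract [:c:] 1"

text \<open>The ring A together with f : R -> A and g : k(x) -> A is (isomorphic to)
  R \<otimes>_k k(x): f, g are ring homomorphisms agreeing on k, and f maps a k-basis of R
  to a k(x)-basis of A (equivalently, the induced map R \<otimes>_k k(x) -> A,
  r \<otimes> c |-> f r * g c, is a ring isomorphism).\<close>
definition is_base_change_kx ::
  "('k::field \<Rightarrow> 'r::comm_ring_1) \<Rightarrow> ('r \<Rightarrow> 'a::comm_ring_1) \<Rightarrow> ('k poly fract \<Rightarrow> 'a) \<Rightarrow> bool" where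
  "is_base_change_kx \<iota> f g \<longleftrightarrow> is_ring_hom f \<and> is_ring_hom g \<and>
     (\<forall>c. f (\<iota> c) = g (const_kx c)) \<and>
     (\<exists>b. is_k_basis \<iota> b \<and>
          (\<forall>a. \<exists>!cs. length cs = length b \<and> a = (\<Sum>i<length b. g (cs ! i) * f (b ! i))))"

end

theory Submission
  imports Defs "HOL-Library.Function_Algebras"
begin

text \<open>
  Fix finitely generated modules \<open>M\<close>, \<open>N\<close> over \<open>A = R \<otimes> k(x)\<close> and a free resolution of \<open>M\<close>.
  Vanishing of one Ext group, exactness of the resolution at one spot and vanishing of a cokernel
  all say that the kernel of one matrix over \<open>A\<close> is mapped by a second one into the image of a third.
  After restricting scalars to \<open>k(x)\<close>, generalized inverses turn such a statement into the vanishing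
  of finitely many rational functions, so it is preserved and reflected by the substitution
  \<open>x := c\<close> for all but finitely many \<open>c\<close>. As \<open>k\<close> is uncountable, some \<open>c\<close> is good for all degrees
  simultaneously, and yields \<open>R\<close>-modules whose Ext groups vanish in the same degrees as those
  of \<open>M\<close> and \<open>N\<close>. Independence of Ext of the chosen resolution is needed over \<open>A\<close> and over \<open>R\<close>.
\<close>

subsection \<open>Independence of the free resolution\<close>

text \<open>Substituting \<open>x := c\<close> can lower the rank of a matrix and so enlarge its
  kernel, hence exactness and cocycle conditions, unlike equations, need not survive it. Generalized
  inverses repair this: \<open>B G B = B\<close> is itself an equation between rational functions,
  so it holds at \<open>c\<close> wherever \<open>B\<close> and \<open>G\<close> have no pole.
  "Kernel in image" becomes the equation \<open>(1 - E H) C (1 - G B) = 0\<close>, and its failure a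
  nonzero rational function, which stays nonzero where its inverse has no pole either. Thus every
  condition on \<open>c\<close> says that some given rational function is regular at
  \<open>c\<close>. Both directions matter: a nonzero Ext must stay nonzero to count in the supremum
  for \<open>R\<close>, and vanishing ones must stay zero so that the specialized pair still has
  only finitely many nonzero Ext groups. Since \<open>ext_nonzero\<close> quantifies over all free
  resolutions, it carries information only if one exists: over \<open>A\<close> it is built from
  kernels, over \<open>R\<close> it is the specialized one.\<close>

lemma mmul_assoc: "mmul m (mmul n X Y) Z = mmul n X (mmul m Y Z)"
proof (intro ext)
  fix i j
  have "mmul m (mmul n X Y) Z i j = (\<Sum>t<m. \<Sum>l<n. X i l * Y l t * Z t j)"
    by (simp add: mmul_def sum_distrib_right)
  also have "\<dots> = (\<Sum>l<n. \<Sum>t<m. X i l * Y l t * Z t j)"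
    by (rule sum.swap)
  also have "\<dots> = mmul n X (mmul m Y Z) i j"
    by (simp add: mmul_def sum_distrib_left mult.assoc)
  finally show "mmul m (mmul n X Y) Z i j = mmul n X (mmul m Y Z) i j" .
qed

lemma mmul_cong:
  assumes "\<And>l. l < m \<Longrightarrow> X i l = X' i l" and "\<And>l. l < m \<Longrightarrow> Y l j = Y' l j"
  shows "mmul m X Y i j = mmul m X' Y' i j"
  unfolding mmul_def using assms by (intro sum.cong) auto

lemma mmul_diff_left:
  "mmul m (\<lambda>i j. X i j - X' i j) Y i j = mmul m X Y i j - mmul m X' Y i j"
  by (simp add: mmul_def left_diff_distrib sum_subtractf)

lemma mmul_diff_right:
  "mmul m X (\<lambda>i j. Y i j - Y' i j) i j = mmul m X Y i j - mmul m X Y' i j"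
  by (simp add: mmul_def right_diff_distrib sum_subtractf)

lemma mmul_add_right:
  "mmul m X (\<lambda>i j. Y i j + Y' i j) i j = mmul m X Y i j + mmul m X Y' i j"
  by (simp add: mmul_def distrib_left sum.distrib)

definition idm :: "nat \<Rightarrow> nat \<Rightarrow> 'a::comm_ring_1" where
  "idm = (\<lambda>i j. if i = j then 1 else 0)"

lemma mmul_idm_left: "i < m \<Longrightarrow> mmul m idm X i j = X i j"
  by (simp add: mmul_def idm_def of_bool_def if_distrib [of "\<lambda>x. x * _"] cong: if_cong)

lemma mmul_idm_right: "j < m \<Longrightarrow> mmul m X idm i j = X i j"
  by (simp add: mmul_def idm_def of_bool_def if_distrib [of "\<lambda>x. _ * x"] cong: if_cong)

lemma free_resolution_comp:
  assumes "free_resolution n D" and "i < n j" and "l < n (Suc (Suc j))"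
  shows "mmul (n (Suc j)) (D j) (D (Suc j)) i l = 0"
  using assms unfolding free_resolution_def by blast

text \<open>Projectivity of free modules: exactness gives a preimage of each column separately, and
  these are assembled into \<open>Y\<close>.\<close>

lemma free_resolution_lift:
  assumes "free_resolution n D"
    and "\<And>i l. i < n j \<Longrightarrow> l < m \<Longrightarrow> mmul (n (Suc j)) (D j) X i l = 0"
  obtains Y where "\<And>i l. i < n (Suc j) \<Longrightarrow> l < m \<Longrightarrow>
    mmul (n (Suc (Suc j))) (D (Suc j)) Y i l = X i l"
proof -
  have "\<exists>c. \<forall>i<n (Suc j). X i l = (\<Sum>t<n (Suc (Suc j)). D (Suc j) i t * c t)" if "l < m" for l
  proof -
    have "\<forall>i<n j. (\<Sum>t<n (Suc j). D j i t * X t l) = 0"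
      using assms(2) that by (simp add: mmul_def)
    moreover have ex: "\<forall>j v. (\<forall>i<n j. (\<Sum>t<n (Suc j). D j i t * v t) = 0) \<longrightarrow>
        in_colspan (n (Suc j)) (n (Suc (Suc j))) (D (Suc j)) v"
      using assms(1) by (simp add: free_resolution_def)
    ultimately have "in_colspan (n (Suc j)) (n (Suc (Suc j))) (D (Suc j)) (\<lambda>t. X t l)"
      using ex [THEN spec [of _ j], THEN spec [of _ "\<lambda>t. X t l"]] by blast
    then show ?thesis
      by (simp add: in_colspan_def)
  qed
  then obtain c where c: "\<And>l i. l < m \<Longrightarrow> i < n (Suc j) \<Longrightarrow>
      X i l = (\<Sum>t<n (Suc (Suc j)). D (Suc j) i t * c l t)"
    by metis
  show thesis
    by (rule that [of "\<lambda>i l. c l i"]) (simp add: mmul_def c)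
qed

text \<open>The comparison theorem. As both resolutions start with the same matrix, the chain map
  can be the identity in degrees 0 and 1; from there on it is lifted along the second
  resolution.\<close>

lemma chain_map_exists:
  fixes D D' :: "nat \<Rightarrow> nat \<Rightarrow> nat \<Rightarrow> 'a::comm_ring_1"
  assumes res: "free_resolution n D" and res': "free_resolution n' D'"
    and eq: "n' 0 = n 0" "n' 1 = n 1" "D' 0 = D 0"
  obtains \<phi> where "\<phi> 0 = idm" and "\<phi> 1 = idm"
    and "\<And>j i l. i < n' j \<Longrightarrow> l < n (Suc j) \<Longrightarrow>
      mmul (n' (Suc j)) (D' j) (\<phi> (Suc j)) i l = mmul (n j) (\<phi> j) (D j) i l"
proof -
  define sq :: "nat \<Rightarrow> (nat \<Rightarrow> nat \<Rightarrow> 'a) \<Rightarrow> (nat \<Rightarrow> nat \<Rightarrow> 'a) \<Rightarrow> bool" where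
    "sq j a b \<longleftrightarrow> (\<forall>i<n' j. \<forall>l<n (Suc j).
      mmul (n' (Suc j)) (D' j) b i l = mmul (n j) a (D j) i l)" for j a b
  \<comment> \<open>The state of the recursion is a pair of consecutive components, so that a
    commuting square is a property of one state.\<close>
  define P where "P j ab \<longleftrightarrow> sq j (fst ab) (snd ab) \<and> (j = 0 \<longrightarrow> ab = (idm, idm))" for j ab
  have "\<exists>F. \<forall>j. P j (F j) \<and> snd (F j) = fst (F (Suc j))"
  proof (rule dependent_nat_choice)
    have "sq 0 idm idm"
      unfolding sq_def using eq by (simp add: mmul_idm_left mmul_idm_right)
    then show "\<exists>ab. P 0 ab"
      by (auto simp: P_def)
  next
    fix ab j
    assume "P j ab"
    then have sq: "sq j (fst ab) (snd ab)"
      by (simp add: P_def)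
    have "mmul (n' (Suc j)) (D' j) (mmul (n (Suc j)) (snd ab) (D (Suc j))) i l = 0"
      if "i < n' j" "l < n (Suc (Suc j))" for i l
    proof -
      have "mmul (n' (Suc j)) (D' j) (mmul (n (Suc j)) (snd ab) (D (Suc j))) i l
          = mmul (n (Suc j)) (mmul (n' (Suc j)) (D' j) (snd ab)) (D (Suc j)) i l"
        by (simp add: mmul_assoc)
      also have "\<dots> = mmul (n (Suc j)) (mmul (n j) (fst ab) (D j)) (D (Suc j)) i l"
        using sq that by (intro mmul_cong) (auto simp: sq_def)
      also have "\<dots> = mmul (n j) (fst ab) (mmul (n (Suc j)) (D j) (D (Suc j))) i l"
        by (simp add: mmul_assoc)
      also have "\<dots> = 0"
        using free_resolution_comp [OF res _ that(2)] by (simp add: mmul_def [of "n j"])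
      finally show ?thesis .
    qed
    then obtain Y where "\<And>i l. i < n' (Suc j) \<Longrightarrow> l < n (Suc (Suc j)) \<Longrightarrow>
        mmul (n' (Suc (Suc j))) (D' (Suc j)) Y i l = mmul (n (Suc j)) (snd ab) (D (Suc j)) i l"
      using free_resolution_lift [OF res'] by blast
    then have "P (Suc j) (snd ab, Y)"
      by (simp add: P_def sq_def)
    then show "\<exists>y. P (Suc j) y \<and> snd ab = fst y"
      by force
  qed
  then obtain F where F: "\<And>j. P j (F j)" "\<And>j. snd (F j) = fst (F (Suc j))"
    by blast
  show thesis
  proof (rule that [of "\<lambda>j. fst (F j)"])
    show "fst (F 0) = idm" "fst (F 1) = idm"
      using F(1) [of 0] F(2) [of 0] by (simp_all add: P_def)
  next
    fix j i l assume "i < n' j" "l < n (Suc j)"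
    then show "mmul (n' (Suc j)) (D' j) (fst (F (Suc j))) i l = mmul (n j) (fst (F j)) (D j) i l"
      using F(1) [of j] F(2) [of j] by (simp add: P_def sq_def)
  qed
qed

text \<open>Because \<theta> vanishes in degree 1, the homotopy can start with zero matrices; the
  later ones are lifts.\<close>

lemma null_homotopy_exists:
  fixes D :: "nat \<Rightarrow> nat \<Rightarrow> nat \<Rightarrow> 'a::comm_ring_1"
  assumes res: "free_resolution n D"
    and chain: "\<And>j i l. i < n j \<Longrightarrow> l < n (Suc j) \<Longrightarrow>
      mmul (n (Suc j)) (D j) (\<theta> (Suc j)) i l = mmul (n j) (\<theta> j) (D j) i l"
    and zero: "\<And>i l. i < n 1 \<Longrightarrow> l < n 1 \<Longrightarrow> \<theta> 1 i l = 0"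
  obtains h where "\<And>j i l. i < n (Suc j) \<Longrightarrow> l < n (Suc j) \<Longrightarrow>
    \<theta> (Suc j) i l = mmul (n (Suc (Suc j))) (D (Suc j)) (h (Suc j)) i l + mmul (n j) (h j) (D j) i l"
proof -
  define P where "P j ab \<longleftrightarrow> (\<forall>i<n (Suc j). \<forall>l<n (Suc j).
      \<theta> (Suc j) i l = mmul (n (Suc (Suc j))) (D (Suc j)) (snd ab) i l + mmul (n j) (fst ab) (D j) i l)"
    for j ab
  have "\<exists>F. \<forall>j. P j (F j) \<and> snd (F j) = fst (F (Suc j))"
  proof (rule dependent_nat_choice)
    have "P 0 (\<lambda>i j. 0, \<lambda>i j. 0)"
      using zero by (simp add: P_def mmul_def)
    then show "\<exists>ab. P 0 ab"
      by blast
  next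
    fix ab j
    assume P: "P j ab"
    let ?b = "snd ab"
    let ?X = "\<lambda>i l. \<theta> (Suc (Suc j)) i l - mmul (n (Suc j)) ?b (D (Suc j)) i l"
    \<comment> \<open>With \<open>a = fst ab\<close> and \<open>b = snd ab\<close>, the product is
      \<open>(\<theta> (Suc j) - D (Suc j) b) D (Suc j) = a (D j) (D (Suc j)) = 0\<close>, so
      \<open>?X\<close> lifts, and its lift is the next component.\<close>
    have "mmul (n (Suc (Suc j))) (D (Suc j)) ?X i l = 0"
      if "i < n (Suc j)" "l < n (Suc (Suc j))" for i l
    proof -
      have "mmul (n (Suc (Suc j))) (D (Suc j)) ?X i l
          = mmul (n (Suc j)) (\<theta> (Suc j)) (D (Suc j)) i l
            - mmul (n (Suc j)) (mmul (n (Suc (Suc j))) (D (Suc j)) ?b) (D (Suc j)) i l"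
        using that by (simp add: mmul_diff_right chain mmul_assoc)
      also have "\<dots> = mmul (n (Suc j))
          (\<lambda>i l. \<theta> (Suc j) i l - mmul (n (Suc (Suc j))) (D (Suc j)) ?b i l) (D (Suc j)) i l"
        by (simp add: mmul_diff_left)
      also have "\<dots> = mmul (n (Suc j)) (mmul (n j) (fst ab) (D j)) (D (Suc j)) i l"
        using P that by (intro mmul_cong) (auto simp: P_def)
      also have "\<dots> = mmul (n j) (fst ab) (mmul (n (Suc j)) (D j) (D (Suc j))) i l"
        by (simp add: mmul_assoc)
      also have "\<dots> = 0"
        using free_resolution_comp [OF res _ that(2)] by (simp add: mmul_def [of "n j"])
      finally show ?thesis .
    qed
    then obtain Y where Y: "\<And>i l. i < n (Suc (Suc j)) \<Longrightarrow> l < n (Suc (Suc j)) \<Longrightarrow>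
        mmul (n (Suc (Suc (Suc j)))) (D (Suc (Suc j))) Y i l = ?X i l"
      using free_resolution_lift [OF res, of "Suc j" "n (Suc (Suc j))" ?X] by blast
    have "P (Suc j) (?b, Y)"
      using Y by (simp add: P_def)
    then show "\<exists>y. P (Suc j) y \<and> snd ab = fst y"
      by force
  qed
  then obtain F where F: "\<And>j. P j (F j)" "\<And>j. snd (F j) = fst (F (Suc j))"
    by blast
  show thesis
  proof (rule that [of "\<lambda>j. fst (F j)"])
    fix j i l assume "i < n (Suc j)" "l < n (Suc j)"
    then show "\<theta> (Suc j) i l = mmul (n (Suc (Suc j))) (D (Suc j)) (fst (F (Suc j))) i l
        + mmul (n j) (fst (F j)) (D j) i l"
      using F(1) [of j] F(2) [of j] by (simp add: P_def)
  qed
qed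

text \<open>\<open>X\<close> represents the zero map from A^m to N = coker P; \<open>W\<close>
  collects the witnesses for all columns.\<close>

definition cols_in :: "nat \<Rightarrow> nat \<Rightarrow> (nat \<Rightarrow> nat \<Rightarrow> 'a::comm_ring_1) \<Rightarrow> nat \<Rightarrow> (nat \<Rightarrow> nat \<Rightarrow> 'a) \<Rightarrow> bool" where
  "cols_in p q P m X \<longleftrightarrow> (\<exists>W. \<forall>r<p. \<forall>l<m. X r l = mmul q P W r l)"

lemma cols_in_iff: "cols_in p q P m X \<longleftrightarrow> (\<forall>l<m. in_colspan p q P (\<lambda>r. X r l))"
proof
  assume "cols_in p q P m X"
  then obtain W where W: "\<forall>r<p. \<forall>l<m. X r l = mmul q P W r l"
    by (auto simp: cols_in_def)
  show "\<forall>l<m. in_colspan p q P (\<lambda>r. X r l)"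
  proof (intro allI impI)
    fix l assume "l < m"
    with W show "in_colspan p q P (\<lambda>r. X r l)"
      unfolding in_colspan_def by (intro exI [of _ "\<lambda>t. W t l"]) (simp add: mmul_def)
  qed
next
  assume "\<forall>l<m. in_colspan p q P (\<lambda>r. X r l)"
  then obtain c where "\<And>l r. l < m \<Longrightarrow> r < p \<Longrightarrow> X r l = (\<Sum>t<q. P r t * c l t)"
    unfolding in_colspan_def by metis
  then show "cols_in p q P m X"
    unfolding cols_in_def by (intro exI [of _ "\<lambda>t l. c l t"]) (simp add: mmul_def)
qed

lemma cols_in_cong:
  "(\<And>r l. r < p \<Longrightarrow> l < m \<Longrightarrow> X r l = X' r l) \<Longrightarrow> cols_in p q P m X \<longleftrightarrow> cols_in p q P m X'"
  by (simp add: cols_in_def)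

lemma cols_in_diff:
  assumes "cols_in p q P m X" and "cols_in p q P m X'"
  shows "cols_in p q P m (\<lambda>r l. X r l - X' r l)"
proof -
  obtain W W' where "\<forall>r<p. \<forall>l<m. X r l = mmul q P W r l" "\<forall>r<p. \<forall>l<m. X' r l = mmul q P W' r l"
    using assms by (auto simp: cols_in_def)
  then show ?thesis
    unfolding cols_in_def
    by (intro exI [of _ "\<lambda>i j. W i j - W' i j"]) (simp add: mmul_diff_right)
qed

lemma cols_in_mmul:
  assumes "cols_in p q P m X"
  shows "cols_in p q P k (mmul m X A)"
proof -
  obtain W where W: "\<forall>r<p. \<forall>l<m. X r l = mmul q P W r l"
    using assms by (auto simp: cols_in_def)
  have "mmul m X A r l = mmul q P (mmul m W A) r l" if "r < p" for r l
  proof -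
    have "mmul m X A r l = mmul m (mmul q P W) A r l"
      using W that by (intro mmul_cong) auto
    then show ?thesis
      by (simp add: mmul_assoc)
  qed
  then show ?thesis
    unfolding cols_in_def by blast
qed

lemma ext_nonzero_res_Suc:
  "ext_nonzero_res n D p q P (Suc j) \<longleftrightarrow>
    (\<exists>Y. cols_in p q P (n (Suc (Suc j))) (mmul (n (Suc j)) Y (D (Suc j))) \<and>
      \<not> (\<exists>Z. cols_in p q P (n (Suc j)) (\<lambda>r m. Y r m - mmul (n j) Z (D j) r m)))"
  by (simp add: ext_nonzero_res_def cols_in_iff)

text \<open>Pulling a cocycle \<open>Y\<close> back along a chain map \<psi> cannot make it a
  coboundary, since \<psi> followed by the comparison in the other direction is homotopic to the
  identity. The hypotheses are symmetric in the two resolutions, so one implication is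
  enough.\<close>

lemma ext_nonzero_res_mono:
  fixes D D' :: "nat \<Rightarrow> nat \<Rightarrow> nat \<Rightarrow> 'a::comm_ring_1"
  assumes res: "free_resolution n D" and res': "free_resolution n' D'"
    and eq: "n' 0 = n 0" "n' 1 = n 1" "D' 0 = D 0"
    and ext: "ext_nonzero_res n D p q P i"
  shows "ext_nonzero_res n' D' p q P i"
proof (cases i)
  case 0
  with ext eq show ?thesis
    by (simp add: ext_nonzero_res_def)
next
  case (Suc j)
  obtain \<phi> where \<phi>: "\<phi> 0 = idm" "\<phi> 1 = idm" "\<And>j i l. i < n' j \<Longrightarrow> l < n (Suc j) \<Longrightarrow>
      mmul (n' (Suc j)) (D' j) (\<phi> (Suc j)) i l = mmul (n j) (\<phi> j) (D j) i l"
    using chain_map_exists [OF res res' eq] by blast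
  obtain \<psi> where \<psi>: "\<psi> 0 = idm" "\<psi> 1 = idm" "\<And>j i l. i < n j \<Longrightarrow> l < n' (Suc j) \<Longrightarrow>
      mmul (n (Suc j)) (D j) (\<psi> (Suc j)) i l = mmul (n' j) (\<psi> j) (D' j) i l"
    using chain_map_exists [OF res' res eq [symmetric]] by blast
  \<comment> \<open>The difference between the composite chain map and the identity; it is zero in
    degree 1, hence null-homotopic.\<close>
  define \<theta> where "\<theta> j = (\<lambda>i l. mmul (n' j) (\<psi> j) (\<phi> j) i l - idm i l)" for j
  have "mmul (n (Suc j)) (D j) (\<theta> (Suc j)) i l = mmul (n j) (\<theta> j) (D j) i l"
    if "i < n j" "l < n (Suc j)" for i j l
  proof -
    have "mmul (n (Suc j)) (D j) (mmul (n' (Suc j)) (\<psi> (Suc j)) (\<phi> (Suc j))) i l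
        = mmul (n' (Suc j)) (mmul (n (Suc j)) (D j) (\<psi> (Suc j))) (\<phi> (Suc j)) i l"
      by (simp add: mmul_assoc)
    also have "\<dots> = mmul (n' (Suc j)) (mmul (n' j) (\<psi> j) (D' j)) (\<phi> (Suc j)) i l"
      using that by (intro mmul_cong) (auto simp: \<psi>(3))
    also have "\<dots> = mmul (n' j) (\<psi> j) (mmul (n' (Suc j)) (D' j) (\<phi> (Suc j))) i l"
      by (simp add: mmul_assoc)
    also have "\<dots> = mmul (n' j) (\<psi> j) (mmul (n j) (\<phi> j) (D j)) i l"
      using that by (intro mmul_cong) (auto simp: \<phi>(3))
    also have "\<dots> = mmul (n j) (mmul (n' j) (\<psi> j) (\<phi> j)) (D j) i l"
      by (simp add: mmul_assoc)
    finally show ?thesis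
      using that by (simp add: \<theta>_def mmul_diff_left mmul_diff_right mmul_idm_left mmul_idm_right)
  qed
  moreover have "\<theta> 1 i l = 0" if "i < n 1" "l < n 1" for i l
    using that eq \<phi> \<psi> by (simp add: \<theta>_def mmul_idm_left)
  ultimately obtain h where h: "\<And>j i l. i < n (Suc j) \<Longrightarrow> l < n (Suc j) \<Longrightarrow>
    \<theta> (Suc j) i l = mmul (n (Suc (Suc j))) (D (Suc j)) (h (Suc j)) i l + mmul (n j) (h j) (D j) i l"
    using null_homotopy_exists [OF res, of \<theta>] by blast
  obtain Y where Y: "cols_in p q P (n (Suc (Suc j))) (mmul (n (Suc j)) Y (D (Suc j)))"
    and notbd: "\<And>Z. \<not> cols_in p q P (n (Suc j)) (\<lambda>r m. Y r m - mmul (n j) Z (D j) r m)"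
    using ext Suc by (auto simp: ext_nonzero_res_Suc)
  let ?Y' = "mmul (n (Suc j)) Y (\<psi> (Suc j))"
  have "cols_in p q P (n' (Suc (Suc j))) (mmul (n' (Suc j)) ?Y' (D' (Suc j)))"
  proof -
    have "mmul (n' (Suc j)) ?Y' (D' (Suc j)) r l
        = mmul (n (Suc (Suc j))) (mmul (n (Suc j)) Y (D (Suc j))) (\<psi> (Suc (Suc j))) r l"
      if "l < n' (Suc (Suc j))" for r l
      unfolding mmul_assoc using that by (intro mmul_cong) (auto simp: \<psi>(3))
    then show ?thesis
      using cols_in_mmul [OF Y] by (subst cols_in_cong) auto
  qed
  moreover have "\<not> cols_in p q P (n' (Suc j)) (\<lambda>r m. ?Y' r m - mmul (n' j) Z' (D' j) r m)" for Z'
  proof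
    assume "cols_in p q P (n' (Suc j)) (\<lambda>r m. ?Y' r m - mmul (n' j) Z' (D' j) r m)"
    \<comment> \<open>Multiply by \<phi> and subtract \<open>Y D h\<close>, which lies in the image
      of \<open>P\<close> because \<open>Y\<close> is a cocycle. The homotopy formula turns the
      result into \<open>Y\<close> minus a coboundary, a contradiction.\<close>
    from cols_in_mmul [OF this, of "n (Suc j)" "\<phi> (Suc j)"]
    have "cols_in p q P (n (Suc j)) (\<lambda>r m. mmul (n' (Suc j))
        (\<lambda>r m. ?Y' r m - mmul (n' j) Z' (D' j) r m) (\<phi> (Suc j)) r m
        - mmul (n (Suc (Suc j))) (mmul (n (Suc j)) Y (D (Suc j))) (h (Suc j)) r m)"
      by (rule cols_in_diff [OF _ cols_in_mmul [OF Y]])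
    moreover have "mmul (n' (Suc j))
        (\<lambda>r m. ?Y' r m - mmul (n' j) Z' (D' j) r m) (\<phi> (Suc j)) r m
        - mmul (n (Suc (Suc j))) (mmul (n (Suc j)) Y (D (Suc j))) (h (Suc j)) r m
      = Y r m - mmul (n j) (\<lambda>r m. mmul (n' j) Z' (\<phi> j) r m - mmul (n (Suc j)) Y (h j) r m) (D j) r m"
      if "m < n (Suc j)" for r m
    proof -
      have 1: "mmul (n' (Suc j)) (mmul (n' j) Z' (D' j)) (\<phi> (Suc j)) r m
          = mmul (n j) (mmul (n' j) Z' (\<phi> j)) (D j) r m"
        unfolding mmul_assoc using that by (intro mmul_cong) (auto simp: \<phi>(3))
      have "mmul (n' (Suc j)) ?Y' (\<phi> (Suc j)) r m - Y r m
          = mmul (n (Suc j)) Y (\<theta> (Suc j)) r m"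
        using that by (simp add: \<theta>_def mmul_diff_right mmul_idm_right mmul_assoc)
      also have "\<dots> = mmul (n (Suc j)) Y (\<lambda>i l.
          mmul (n (Suc (Suc j))) (D (Suc j)) (h (Suc j)) i l + mmul (n j) (h j) (D j) i l) r m"
        using that by (intro mmul_cong) (auto simp: h)
      also have "\<dots> = mmul (n (Suc (Suc j))) (mmul (n (Suc j)) Y (D (Suc j))) (h (Suc j)) r m
          + mmul (n j) (mmul (n (Suc j)) Y (h j)) (D j) r m"
        by (simp add: mmul_add_right mmul_assoc)
      finally show ?thesis
        unfolding mmul_diff_left 1 by (simp add: algebra_simps)
    qed
    ultimately show False
      using notbd [of "\<lambda>r m. mmul (n' j) Z' (\<phi> j) r m - mmul (n (Suc j)) Y (h j) r m"]
      by (subst (asm) cols_in_cong) auto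
  qed
  ultimately show ?thesis
    unfolding Suc ext_nonzero_res_Suc by blast
qed

text \<open>Reduces the quantifier over all resolutions to a test on any single one.\<close>

lemma ext_nonzero_iff_res:
  assumes "free_resolution n D"
  shows "ext_nonzero (n 0) (n 1) (D 0) p q P i \<longleftrightarrow> ext_nonzero_res n D p q P i"
  unfolding ext_nonzero_def using assms ext_nonzero_res_mono [OF assms] by blast

subsection \<open>Kernel-image inclusions and generalized inverses\<close>

text \<open>\<open>C\<close> maps the kernel of \<open>B\<close> into the image of \<open>E\<close>.
  The index types are arbitrary because restriction of scalars produces pairs as indices, and the
  unknowns for Ext are indexed by disjoint sums.\<close>

definition ker_in_im ::
  "'i set \<Rightarrow> 'j set \<Rightarrow> 'l set \<Rightarrow> 'm set \<Rightarrow> ('i \<Rightarrow> 'j \<Rightarrow> 'a::comm_ring_1) \<Rightarrow> ('l \<Rightarrow> 'j \<Rightarrow> 'a) \<Rightarrow> ('l \<Rightarrow> 'm \<Rightarrow> 'a) \<Rightarrow> bool"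
  where "ker_in_im I J L M B C E \<longleftrightarrow>
    (\<forall>u. (\<forall>i\<in>I. (\<Sum>j\<in>J. B i j * u j) = 0) \<longrightarrow>
      (\<exists>w. \<forall>l\<in>L. (\<Sum>j\<in>J. C l j * u j) = (\<Sum>m\<in>M. E l m * w m)))"

text \<open>The von Neumann condition \<open>B G B = B\<close>.\<close>

definition gen_inverse :: "'i set \<Rightarrow> 'j set \<Rightarrow> ('i \<Rightarrow> 'j \<Rightarrow> 'a::comm_ring_1) \<Rightarrow> ('j \<Rightarrow> 'i \<Rightarrow> 'a) \<Rightarrow> bool" where
  "gen_inverse I J B G \<longleftrightarrow>
    (\<forall>i\<in>I. \<forall>j\<in>J. (\<Sum>j'\<in>J. \<Sum>i'\<in>I. B i j' * G j' i' * B i' j) = B i j)"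

lemma sum_fun_apply: "(\<Sum>i\<in>I. F i) x = (\<Sum>i\<in>I. F i x)"
  by (induction I rule: infinite_finite_induct) auto

text \<open>A linear map \<open>f\<close> over a field has a linear right inverse \<open>g\<close>
  on its image, so \<open>f g f = f\<close>; \<open>G\<close> is the matrix of
  \<open>g\<close>.\<close>

lemma gen_inverse_exists:
  fixes B :: "'i \<Rightarrow> 'j \<Rightarrow> 'f::field"
  assumes fin: "finite I" "finite J"
  obtains G where "gen_inverse I J B G"
proof -
  let ?s1 = "\<lambda>(c::'f) (u::'j \<Rightarrow> 'f) x. c * u x"
  let ?s2 = "\<lambda>(c::'f) (u::'i \<Rightarrow> 'f) x. c * u x"
  interpret V: vector_space ?s1
    by unfold_locales (auto simp: fun_eq_iff algebra_simps)
  interpret W: vector_space ?s2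
    by unfold_locales (auto simp: fun_eq_iff algebra_simps)
  interpret VW: vector_space_pair ?s1 ?s2 ..
  \<comment> \<open>Entries outside \<open>I\<close> are set to 0, so that each \<open>f u\<close>
    is a finite combination of the unit vectors \<delta> and \<open>g_apply\<close> covers
    it.\<close>
  define f where "f u = (\<lambda>i. if i \<in> I then \<Sum>j\<in>J. B i j * u j else 0)" for u
  have "Vector_Spaces.linear ?s1 ?s2 f"
    by unfold_locales
      (auto simp: f_def fun_eq_iff distrib_left sum.distrib sum_distrib_left mult.left_commute)
  from VW.linear_exists_right_inverse_on [OF this V.subspace_UNIV]
  obtain g where g: "Vector_Spaces.linear ?s2 ?s1 g" and fg: "\<And>u. f (g (f u)) = f u"
    by auto
  interpret g: Vector_Spaces.linear ?s2 ?s1 g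
    by (rule g)
  define \<delta> :: "'i \<Rightarrow> 'i \<Rightarrow> 'f" where "\<delta> i = (\<lambda>x. if x = i then 1 else 0)" for i
  have g_apply: "g v j = (\<Sum>i\<in>I. v i * g (\<delta> i) j)" if "\<And>i. i \<notin> I \<Longrightarrow> v i = 0" for v j
  proof -
    have "v = (\<Sum>i\<in>I. ?s2 (v i) (\<delta> i))"
      using that fin
      by (auto simp: fun_eq_iff sum_fun_apply \<delta>_def if_distrib [of "\<lambda>x. _ * x"] cong: if_cong)
    then have "g v = g (\<Sum>i\<in>I. ?s2 (v i) (\<delta> i))"
      by (rule arg_cong)
    also have "\<dots> = (\<Sum>i\<in>I. ?s1 (v i) (g (\<delta> i)))"
      by (simp only: g.sum g.scale)
    finally show ?thesis
      by (simp add: sum_fun_apply)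
  qed
  have "gen_inverse I J B (\<lambda>j i. g (\<delta> i) j)"
    unfolding gen_inverse_def
  proof (intro ballI)
    fix i j assume ij: "i \<in> I" "j \<in> J"
    define e :: "'j \<Rightarrow> 'f" where "e = (\<lambda>x. if x = j then 1 else 0)"
    have fe: "f e i' = B i' j" if "i' \<in> I" for i'
      using that ij fin by (simp add: f_def e_def if_distrib [of "\<lambda>x. _ * x"] cong: if_cong)
    have "B i j = f (g (f e)) i"
      using fg fe ij by simp
    also have "\<dots> = (\<Sum>j'\<in>J. B i j' * (\<Sum>i'\<in>I. f e i' * g (\<delta> i') j'))"
      using ij by (subst f_def, subst g_apply) (auto simp: f_def)
    also have "\<dots> = (\<Sum>j'\<in>J. \<Sum>i'\<in>I. B i j' * g (\<delta> i') j' * B i' j)"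
      by (simp add: sum_distrib_left fe mult_ac)
    finally show "(\<Sum>j'\<in>J. \<Sum>i'\<in>I. B i j' * g (\<delta> i') j' * B i' j) = B i j" ..
  qed
  then show thesis ..
qed

lemma sum_mult_assoc:
  fixes a :: "'x \<Rightarrow> 'a::comm_ring_1"
  shows "(\<Sum>x\<in>X. a x * (\<Sum>y\<in>Y. b x y * c y)) = (\<Sum>y\<in>Y. (\<Sum>x\<in>X. a x * b x y) * c y)"
  unfolding sum_distrib_left sum_distrib_right mult.assoc by (rule sum.swap)

lemma sum_id_minus_mult:
  fixes X :: "'l \<Rightarrow> 'm \<Rightarrow> 'a::comm_ring_1"
  assumes "finite L" and "l \<in> L"
  shows "(\<Sum>l'\<in>L. ((if l = l' then 1 else 0) - (\<Sum>m\<in>M. X l m * Y m l')) * v l')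
    = v l - (\<Sum>m\<in>M. X l m * (\<Sum>l'\<in>L. Y m l' * v l'))"
proof -
  have "(\<Sum>l'\<in>L. (\<Sum>m\<in>M. X l m * Y m l') * v l') = (\<Sum>m\<in>M. X l m * (\<Sum>l'\<in>L. Y m l' * v l'))"
    by (simp add: sum_distrib_left sum_distrib_right mult.assoc) (rule sum.swap)
  then show ?thesis
    using assms by (simp add: left_diff_distrib sum_subtractf if_distrib [of "\<lambda>x. x * _"] cong: if_cong)
qed

lemma gen_inverse_mult_complement:
  fixes B :: "'i \<Rightarrow> 'j \<Rightarrow> 'a::comm_ring_1"
  assumes "finite J" and "gen_inverse I J B G" and "i \<in> I" and "j \<in> J"
  shows "(\<Sum>j'\<in>J. B i j' * ((if j' = j then 1 else 0) - (\<Sum>i\<in>I. G j' i * B i j))) = 0"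
proof -
  have "(\<Sum>j'\<in>J. B i j' * ((if j' = j then 1 else 0) - (\<Sum>i\<in>I. G j' i * B i j)))
      = B i j - (\<Sum>j'\<in>J. \<Sum>i'\<in>I. B i j' * G j' i' * B i' j)"
    using assms by (simp add: right_diff_distrib sum_subtractf sum_distrib_left mult.assoc
        if_distrib [of "\<lambda>x. _ * x"] cong: if_cong)
  also have "\<dots> = 0"
    using assms by (simp add: gen_inverse_def)
  finally show ?thesis .
qed

text \<open>Entry \<open>(l, j)\<close> of the matrix \<open>(1 - E H) C (1 - G B)\<close>.\<close>

definition defect ::
  "'i set \<Rightarrow> 'j set \<Rightarrow> 'l set \<Rightarrow> 'm set \<Rightarrow> ('i \<Rightarrow> 'j \<Rightarrow> 'a::comm_ring_1) \<Rightarrow> ('l \<Rightarrow> 'j \<Rightarrow> 'a) \<Rightarrow> ('l \<Rightarrow> 'm \<Rightarrow> 'a) \<Rightarrow>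
    ('j \<Rightarrow> 'i \<Rightarrow> 'a) \<Rightarrow> ('m \<Rightarrow> 'l \<Rightarrow> 'a) \<Rightarrow> 'l \<Rightarrow> 'j \<Rightarrow> 'a"
  where "defect I J L M B C E G H l j =
    (\<Sum>l'\<in>L. ((if l = l' then 1 else 0) - (\<Sum>m\<in>M. E l m * H m l')) *
      (\<Sum>j'\<in>J. C l' j' * ((if j' = j then 1 else 0) - (\<Sum>i\<in>I. G j' i * B i j))))"

text \<open>With generalized inverses \<open>G\<close> of \<open>B\<close> and \<open>H\<close> of \<open>E\<close>, the columns of \<open>1 - G B\<close>
  span the kernel of \<open>B\<close> and the image of \<open>E\<close> is the kernel of \<open>1 - E H\<close>.\<close>

lemma ker_in_im_iff_defect:
  fixes B :: "'i \<Rightarrow> 'j \<Rightarrow> 'a::comm_ring_1"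
  assumes fin: "finite I" "finite J" "finite L" "finite M"
    and G: "gen_inverse I J B G" and H: "gen_inverse L M E H"
  shows "ker_in_im I J L M B C E \<longleftrightarrow> (\<forall>l\<in>L. \<forall>j\<in>J. defect I J L M B C E G H l j = 0)"
proof
  assume *: "ker_in_im I J L M B C E"
  show "\<forall>l\<in>L. \<forall>j\<in>J. defect I J L M B C E G H l j = 0"
  proof (intro ballI)
    fix l j assume lj: "l \<in> L" "j \<in> J"
    \<comment> \<open>Column \<open>j\<close> of \<open>1 - G B\<close>, a vector in the kernel of
      \<open>B\<close>.\<close>
    define u where "u j' = (if j' = j then 1 else 0) - (\<Sum>i\<in>I. G j' i * B i j)" for j'
    have "(\<Sum>j'\<in>J. B i j' * u j') = 0" if "i \<in> I" for i
      unfolding u_def by (rule gen_inverse_mult_complement [OF fin(2) G that lj(2)])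
    with * obtain w where w: "\<And>l'. l' \<in> L \<Longrightarrow> (\<Sum>j'\<in>J. C l' j' * u j') = (\<Sum>m\<in>M. E l' m * w m)"
      unfolding ker_in_im_def by blast
    have "defect I J L M B C E G H l j =
        (\<Sum>l'\<in>L. ((if l = l' then 1 else 0) - (\<Sum>m\<in>M. E l m * H m l')) * (\<Sum>m\<in>M. E l' m * w m))"
      unfolding defect_def u_def [symmetric] using w by (intro sum.cong) auto
    also have "\<dots> = (\<Sum>m\<in>M. E l m * w m) - (\<Sum>m'\<in>M. \<Sum>l'\<in>L. \<Sum>m\<in>M. E l m' * H m' l' * E l' m * w m)"
      using lj fin by (subst sum_id_minus_mult) (simp_all add: sum_distrib_left mult.assoc)
    also have "(\<Sum>m'\<in>M. \<Sum>l'\<in>L. \<Sum>m\<in>M. E l m' * H m' l' * E l' m * w m)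
        = (\<Sum>m\<in>M. (\<Sum>m'\<in>M. \<Sum>l'\<in>L. E l m' * H m' l' * E l' m) * w m)"
    proof -
      have "(\<Sum>m'\<in>M. \<Sum>l'\<in>L. \<Sum>m\<in>M. E l m' * H m' l' * E l' m * w m)
          = (\<Sum>m'\<in>M. \<Sum>m\<in>M. \<Sum>l'\<in>L. E l m' * H m' l' * E l' m * w m)"
        by (intro sum.cong refl sum.swap)
      also have "\<dots> = (\<Sum>m\<in>M. \<Sum>m'\<in>M. \<Sum>l'\<in>L. E l m' * H m' l' * E l' m * w m)"
        by (rule sum.swap)
      finally show ?thesis
        by (simp only: sum_distrib_right)
    qed
    also have "\<dots> = (\<Sum>m\<in>M. E l m * w m)"
      using H lj by (intro sum.cong) (auto simp: gen_inverse_def)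
    finally show "defect I J L M B C E G H l j = 0"
      by simp
  qed
next
  assume *: "\<forall>l\<in>L. \<forall>j\<in>J. defect I J L M B C E G H l j = 0"
  show "ker_in_im I J L M B C E"
    unfolding ker_in_im_def
  proof (intro allI impI)
    fix u assume u: "\<forall>i\<in>I. (\<Sum>j\<in>J. B i j * u j) = 0"
    define v where "v l = (\<Sum>j\<in>J. C l j * u j)" for l
    let ?Q = "\<lambda>j' j. (if j' = j then 1 else 0) - (\<Sum>i\<in>I. G j' i * B i j)"
    have Qu: "(\<Sum>j\<in>J. ?Q j' j * u j) = u j'" if "j' \<in> J" for j'
      using that fin u by (simp add: sum_id_minus_mult)
    \<comment> \<open>Since \<open>u = (1 - G B) u\<close>, the vanishing defect gives
      \<open>(1 - E H) C u = 0\<close>. So \<open>v = C u\<close> equals \<open>E (H v)\<close>, and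
      \<open>H v\<close> is the required preimage.\<close>
    have "v l = (\<Sum>m\<in>M. E l m * (\<Sum>l'\<in>L. H m l' * v l'))" if l: "l \<in> L" for l
    proof -
      have v: "v l' = (\<Sum>j\<in>J. (\<Sum>j'\<in>J. C l' j' * ?Q j' j) * u j)" for l'
      proof -
        have "v l' = (\<Sum>j'\<in>J. C l' j' * (\<Sum>j\<in>J. ?Q j' j * u j))"
          by (simp add: v_def Qu)
        also have "\<dots> = (\<Sum>j\<in>J. (\<Sum>j'\<in>J. C l' j' * ?Q j' j) * u j)"
          by (rule sum_mult_assoc)
        finally show ?thesis .
      qed
      have "(\<Sum>l'\<in>L. ((if l = l' then 1 else 0) - (\<Sum>m\<in>M. E l m * H m l')) * v l')
          = (\<Sum>l'\<in>L. ((if l = l' then 1 else 0) - (\<Sum>m\<in>M. E l m * H m l')) *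
            (\<Sum>j\<in>J. (\<Sum>j'\<in>J. C l' j' * ?Q j' j) * u j))"
        by (rule sum.cong [OF refl]) (rule arg_cong [OF v])
      also have "\<dots> = (\<Sum>j\<in>J. defect I J L M B C E G H l j * u j)"
        unfolding defect_def by (rule sum_mult_assoc)
      also have "\<dots> = 0"
        using * l by simp
      finally show ?thesis
        using l fin by (simp add: sum_id_minus_mult)
    qed
    then show "\<exists>w. \<forall>l\<in>L. (\<Sum>j\<in>J. C l j * u j) = (\<Sum>m\<in>M. E l m * w m)"
      unfolding v_def [symmetric] by (intro exI [of _ "\<lambda>m. \<Sum>l'\<in>L. H m l' * v l'"] ballI)
  qed
qed

subsection \<open>Restriction of scalars and evaluation of rational functions\<close>

lemma ker_in_im_cong:
  assumes "\<And>i j. i \<in> I \<Longrightarrow> j \<in> J \<Longrightarrow> B i j = B' i j"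
    and "\<And>l j. l \<in> L \<Longrightarrow> j \<in> J \<Longrightarrow> C l j = C' l j"
    and "\<And>l m. l \<in> L \<Longrightarrow> m \<in> M \<Longrightarrow> E l m = E' l m"
  shows "ker_in_im I J L M B C E \<longleftrightarrow> ker_in_im I J L M B' C' E'"
proof -
  have "(\<Sum>j\<in>J. B i j * u j) = (\<Sum>j\<in>J. B' i j * u j)" if "i \<in> I" for i u
    using assms that by simp
  moreover have "(\<Sum>j\<in>J. C l j * u j) = (\<Sum>j\<in>J. C' l j * u j)" if "l \<in> L" for l u
    using assms that by simp
  moreover have "(\<Sum>m\<in>M. E l m * w m) = (\<Sum>m\<in>M. E' l m * w m)" if "l \<in> L" for l w
    using assms that by simp
  ultimately show ?thesis
    unfolding ker_in_im_def by simp
qed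

definition entries :: "'i set \<Rightarrow> 'j set \<Rightarrow> ('i \<Rightarrow> 'j \<Rightarrow> 'a) \<Rightarrow> 'a set" where
  "entries I J B = (\<lambda>(i, j). B i j) ` (I \<times> J)"

lemma entriesI: "i \<in> I \<Longrightarrow> j \<in> J \<Longrightarrow> B i j \<in> entries I J B"
  by (force simp: entries_def)

lemma finite_entries: "finite I \<Longrightarrow> finite J \<Longrightarrow> finite (entries I J B)"
  by (simp add: entries_def)

lemma is_ring_hom_sum:
  assumes "is_ring_hom h"
  shows "h (\<Sum>x\<in>S. F x) = (\<Sum>x\<in>S. h (F x))"
proof -
  have "h 0 + h 0 = h 0 + 0"
    using assms unfolding is_ring_hom_def by (metis add.right_neutral)
  then have "h 0 = 0"
    by (rule add_left_imp_eq)
  then show ?thesis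
    using assms by (induction S rule: infinite_finite_induct) (auto simp: is_ring_hom_def)
qed

text \<open>Used for \<open>R\<close> over \<open>k\<close> and for \<open>A\<close> over
  \<open>k(x)\<close>, with the same \<open>d\<close>. Only the coordinates \<open>co a t\<close>
  with \<open>t < d\<close> are determined.\<close>

locale based_algebra =
  fixes h :: "'f::field \<Rightarrow> 'a::comm_ring_1" and d :: nat and e :: "nat \<Rightarrow> 'a"
    and co :: "'a \<Rightarrow> nat \<Rightarrow> 'f"
  assumes hom: "is_ring_hom h"
    and expand: "(\<Sum>t<d. h (co a t) * e t) = a"
    and co_unique: "(\<Sum>t<d. h (x t) * e t) = a \<Longrightarrow> t < d \<Longrightarrow> co a t = x t"
begin

lemma h_add: "h (x + y) = h x + h y" and h_mult: "h (x * y) = h x * h y"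
  using hom by (auto simp: is_ring_hom_def)

lemma eq_iff_co: "a = b \<longleftrightarrow> (\<forall>t<d. co a t = co b t)"
proof
  assume "\<forall>t<d. co a t = co b t"
  then have "(\<Sum>t<d. h (co a t) * e t) = (\<Sum>t<d. h (co b t) * e t)"
    by simp
  then show "a = b"
    by (simp only: expand)
qed simp

lemma co_add: "t < d \<Longrightarrow> co (a + b) t = co a t + co b t"
  by (rule co_unique) (simp_all add: h_add distrib_right sum.distrib expand)

lemma co_scale: "t < d \<Longrightarrow> co (h x * a) t = x * co a t"
proof (rule co_unique)
  have "(\<Sum>t<d. h (x * co a t) * e t) = h x * (\<Sum>t<d. h (co a t) * e t)"
    by (simp add: h_mult sum_distrib_left mult.assoc)
  then show "(\<Sum>t<d. h (x * co a t) * e t) = h x * a"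
    by (simp only: expand)
qed

lemma co_zero: "t < d \<Longrightarrow> co 0 t = 0"
  using co_scale [of t 0 0] by simp

lemma co_sum: "t < d \<Longrightarrow> co (\<Sum>s\<in>S. F s) t = (\<Sum>s\<in>S. co (F s) t)"
  by (induction S rule: infinite_finite_induct) (auto simp: co_add co_zero)

lemma co_lincomb: "t < d \<Longrightarrow> co (\<Sum>s\<in>S. h (x s) * F s) t = (\<Sum>s\<in>S. x s * co (F s) t)"
  by (simp add: co_sum co_scale)

text \<open>Each entry of \<open>B\<close> is replaced by the \<open>d\<close> by \<open>d\<close>
  matrix of multiplication by it, in the basis \<open>e\<close>.\<close>

definition scalar_mat :: "('i \<Rightarrow> 'j \<Rightarrow> 'a) \<Rightarrow> 'i \<times> nat \<Rightarrow> 'j \<times> nat \<Rightarrow> 'f" where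
  "scalar_mat B p q = co (B (fst p) (fst q) * e (snd q)) (snd p)"

lemma scalar_mat_apply:
  assumes "s < d"
  shows "(\<Sum>q\<in>J \<times> {..<d}. scalar_mat B (i, s) q * x q)
    = co (\<Sum>j\<in>J. B i j * (\<Sum>t<d. h (x (j, t)) * e t)) s"
proof -
  have "co (\<Sum>j\<in>J. B i j * (\<Sum>t<d. h (x (j, t)) * e t)) s
      = co (\<Sum>j\<in>J. \<Sum>t<d. h (x (j, t)) * (B i j * e t)) s"
    by (simp add: sum_distrib_left mult.left_commute)
  also have "\<dots> = (\<Sum>j\<in>J. \<Sum>t<d. x (j, t) * co (B i j * e t) s)"
    using assms by (simp add: co_sum co_scale)
  also have "\<dots> = (\<Sum>q\<in>J \<times> {..<d}. scalar_mat B (i, s) q * x q)"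
    by (simp add: scalar_mat_def sum.cartesian_product split_beta mult.commute)
  finally show ?thesis ..
qed

lemma scalar_mat_apply_co:
  assumes "s < d"
  shows "(\<Sum>q\<in>J \<times> {..<d}. scalar_mat B (i, s) q * co (u (fst q)) (snd q)) = co (\<Sum>j\<in>J. B i j * u j) s"
  using scalar_mat_apply [OF assms, of B i "\<lambda>q. co (u (fst q)) (snd q)" J] by (simp add: expand)

text \<open>Coordinates give a bijection between vectors over the algebra and vectors over the
  field, under which \<open>B\<close> acts as \<open>scalar_mat B\<close>; kernels and images
  therefore correspond.\<close>

lemma ker_in_im_scalar_mat:
  fixes B :: "'i \<Rightarrow> 'j \<Rightarrow> 'a"
  shows "ker_in_im I J L M B C E \<longleftrightarrow>
    ker_in_im (I \<times> {..<d}) (J \<times> {..<d}) (L \<times> {..<d}) (M \<times> {..<d})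
      (scalar_mat B) (scalar_mat C) (scalar_mat E)"
proof
  assume *: "ker_in_im I J L M B C E"
  show "ker_in_im (I \<times> {..<d}) (J \<times> {..<d}) (L \<times> {..<d}) (M \<times> {..<d})
      (scalar_mat B) (scalar_mat C) (scalar_mat E)"
    unfolding ker_in_im_def
  proof (intro allI impI)
    fix x assume x: "\<forall>p\<in>I \<times> {..<d}. (\<Sum>q\<in>J \<times> {..<d}. scalar_mat B p q * x q) = 0"
    define u where "u j = (\<Sum>t<d. h (x (j, t)) * e t)" for j
    have "(\<Sum>j\<in>J. B i j * u j) = 0" if "i \<in> I" for i
      using x that by (subst eq_iff_co) (auto simp: u_def scalar_mat_apply co_zero)
    with * obtain w where w: "\<And>l. l \<in> L \<Longrightarrow> (\<Sum>j\<in>J. C l j * u j) = (\<Sum>m\<in>M. E l m * w m)"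
      unfolding ker_in_im_def by blast
    have "(\<Sum>q\<in>J \<times> {..<d}. scalar_mat C (l, s) q * x q)
        = (\<Sum>q\<in>M \<times> {..<d}. scalar_mat E (l, s) q * co (w (fst q)) (snd q))"
      if "l \<in> L" "s < d" for l s
      using that w by (simp add: scalar_mat_apply expand flip: u_def)
    then show "\<exists>y. \<forall>p\<in>L \<times> {..<d}. (\<Sum>q\<in>J \<times> {..<d}. scalar_mat C p q * x q)
        = (\<Sum>q\<in>M \<times> {..<d}. scalar_mat E p q * y q)"
      by (intro exI [of _ "\<lambda>q. co (w (fst q)) (snd q)"]) auto
  qed
next
  assume *: "ker_in_im (I \<times> {..<d}) (J \<times> {..<d}) (L \<times> {..<d}) (M \<times> {..<d})
      (scalar_mat B) (scalar_mat C) (scalar_mat E)"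
  show "ker_in_im I J L M B C E"
    unfolding ker_in_im_def
  proof (intro allI impI)
    fix u assume u: "\<forall>i\<in>I. (\<Sum>j\<in>J. B i j * u j) = 0"
    let ?x = "\<lambda>q. co (u (fst q)) (snd q)"
    have "\<forall>p\<in>I \<times> {..<d}. (\<Sum>q\<in>J \<times> {..<d}. scalar_mat B p q * ?x q) = 0"
      using u by (auto simp: scalar_mat_apply_co co_zero)
    then obtain y where y: "\<forall>p\<in>L \<times> {..<d}. (\<Sum>q\<in>J \<times> {..<d}. scalar_mat C p q * ?x q)
        = (\<Sum>q\<in>M \<times> {..<d}. scalar_mat E p q * y q)"
      using * [unfolded ker_in_im_def, THEN spec [of _ ?x]] by blast
    have "(\<Sum>j\<in>J. C l j * u j) = (\<Sum>m\<in>M. E l m * (\<Sum>t<d. h (y (m, t)) * e t))" if "l \<in> L" for l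
      using y that by (subst eq_iff_co) (auto simp: scalar_mat_apply expand)
    then show "\<exists>w. \<forall>l\<in>L. (\<Sum>j\<in>J. C l j * u j) = (\<Sum>m\<in>M. E l m * w m)"
      by (intro exI [of _ "\<lambda>m. \<Sum>t<d. h (y (m, t)) * e t"]) blast
  qed
qed

end

section \<open>Rational functions without a pole at a point, and their values\<close>

definition regular :: "'k::field \<Rightarrow> 'k poly fract \<Rightarrow> bool" where
  "regular c q \<longleftrightarrow> (\<exists>a b. poly b c \<noteq> 0 \<and> q = Fract a b)"

text \<open>Evaluation at \<open>c\<close>; a junk value at rational functions with a pole at \<open>c\<close>.\<close>

definition ev :: "'k::field \<Rightarrow> 'k poly fract \<Rightarrow> 'k" where
  "ev c q = (THE y. \<exists>a b. poly b c \<noteq> 0 \<and> q = Fract a b \<and> y = poly a c / poly b c)"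

lemma ev_Fract:
  assumes "poly b c \<noteq> 0"
  shows "ev c (Fract a b) = poly a c / poly b c"
  unfolding ev_def
proof (rule the_equality)
  show "\<exists>a' b'. poly b' c \<noteq> 0 \<and> Fract a b = Fract a' b' \<and> poly a c / poly b c = poly a' c / poly b' c"
    using assms by blast
next
  fix y assume "\<exists>a' b'. poly b' c \<noteq> 0 \<and> Fract a b = Fract a' b' \<and> y = poly a' c / poly b' c"
  then obtain a' b' where *: "poly b' c \<noteq> 0" "Fract a b = Fract a' b'" "y = poly a' c / poly b' c"
    by blast
  have "b \<noteq> 0" "b' \<noteq> 0"
    using assms * by auto
  with * have "a * b' = a' * b"
    by (simp add: eq_fract)
  then have "poly a c * poly b' c = poly a' c * poly b c"
    by (metis poly_mult)
  with * assms show "y = poly a c / poly b c"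
    by (simp add: frac_eq_eq)
qed

lemma regularE:
  assumes "regular c q"
  obtains a b where "poly b c \<noteq> 0" "b \<noteq> 0" "q = Fract a b"
  using assms unfolding regular_def by fastforce

lemma regular_const [simp]: "regular c (const_kx y)"
  unfolding regular_def const_kx_def by (rule exI [of _ "[:y:]"], rule exI [of _ 1]) simp

lemma ev_const [simp]: "ev c (const_kx y) = y"
  unfolding const_kx_def by (simp add: ev_Fract)

lemma const_kx_0: "const_kx 0 = 0" and const_kx_1: "const_kx 1 = 1"
  by (simp_all add: const_kx_def Zero_fract_def One_fract_def one_pCons)

lemma regular_0 [simp]: "regular c 0" and regular_1 [simp]: "regular c 1"
  and ev_0 [simp]: "ev c 0 = 0" and ev_1 [simp]: "ev c 1 = 1"
  using regular_const [of c 0] regular_const [of c 1] ev_const [of c 0] ev_const [of c 1]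
  by (simp_all only: const_kx_0 const_kx_1)

lemma
  assumes "regular c p" and "regular c q"
  shows regular_add: "regular c (p + q)" and ev_add: "ev c (p + q) = ev c p + ev c q"
    and regular_diff: "regular c (p - q)" and ev_diff: "ev c (p - q) = ev c p - ev c q"
    and regular_mult: "regular c (p * q)" and ev_mult: "ev c (p * q) = ev c p * ev c q"
proof -
  obtain a b where ab: "poly b c \<noteq> 0" "b \<noteq> 0" "p = Fract a b"
    using assms(1) by (rule regularE)
  obtain a' b' where ab': "poly b' c \<noteq> 0" "b' \<noteq> 0" "q = Fract a' b'"
    using assms(2) by (rule regularE)
  have bb': "poly (b * b') c \<noteq> 0"
    using ab ab' by simp
  have eqs: "p + q = Fract (a * b' + a' * b) (b * b')" "p - q = Fract (a * b' - a' * b) (b * b')"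
    "p * q = Fract (a * a') (b * b')"
    using ab ab' by simp_all
  show "regular c (p + q)" "regular c (p - q)" "regular c (p * q)"
    unfolding eqs regular_def using bb' by blast+
  have pq: "ev c p = poly a c / poly b c" "ev c q = poly a' c / poly b' c"
    using ab ab' by (simp_all add: ev_Fract)
  show "ev c (p + q) = ev c p + ev c q" "ev c (p - q) = ev c p - ev c q"
    "ev c (p * q) = ev c p * ev c q"
    unfolding eqs pq using ab ab' bb' by (subst ev_Fract; simp add: field_simps)+
qed

lemma
  assumes "\<And>s. s \<in> S \<Longrightarrow> regular c (F s)"
  shows regular_sum: "regular c (\<Sum>s\<in>S. F s)" and ev_sum: "ev c (\<Sum>s\<in>S. F s) = (\<Sum>s\<in>S. ev c (F s))"
proof -
  have "regular c (\<Sum>s\<in>S. F s) \<and> ev c (\<Sum>s\<in>S. F s) = (\<Sum>s\<in>S. ev c (F s))"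
    using assms by (induction S rule: infinite_finite_induct) (auto simp: regular_add ev_add)
  then show "regular c (\<Sum>s\<in>S. F s)" "ev c (\<Sum>s\<in>S. F s) = (\<Sum>s\<in>S. ev c (F s))"
    by auto
qed

lemma regular_if: "regular c (if b then 1 else 0)"
  and ev_if: "ev c (if b then 1 else 0) = (if b then 1 else 0)"
  by simp_all

text \<open>The values of \<open>q\<close> and of its inverse multiply to 1. This expresses
  nonvanishing at \<open>c\<close> as regularity of a further function.\<close>

lemma ev_nonzero:
  assumes "q \<noteq> 0" and "regular c q" and "regular c (inverse q)"
  shows "ev c q \<noteq> 0"
  using assms ev_mult [of c q "inverse q"] by auto

text \<open>A single rational function can only fail to be regular at the finitely many roots of a
  denominator.\<close>

lemma countable_nonregular:
  assumes "countable X"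
  shows "countable {c. \<exists>q\<in>X. \<not> regular c q}"
proof -
  have "countable {c. \<not> regular c q}" for q :: "'a poly fract"
  proof (cases q rule: Fract_cases)
    case (Fract a b)
    then have "{c. \<not> regular c q} \<subseteq> {c. poly b c = 0}"
      by (auto simp: regular_def)
    moreover have "finite {c. poly b c = 0}"
      using Fract by (simp add: poly_roots_finite)
    ultimately show ?thesis
      by (meson countable_finite finite_subset)
  qed
  then have "countable (\<Union>q\<in>X. {c. \<not> regular c q})"
    using assms by blast
  then show ?thesis
    by (rule back_subst [of countable]) auto
qed

text \<open>This rules out a drop of rank at \<open>c\<close>: the generalized inverse specializes
  along with the matrix, as it is given by equations.\<close>

lemma gen_inverse_ev:
  assumes "gen_inverse I J B G"
    and reg: "\<And>i j. i \<in> I \<Longrightarrow> j \<in> J \<Longrightarrow> regular c (B i j)" "\<And>i j. i \<in> I \<Longrightarrow> j \<in> J \<Longrightarrow> regular c (G j i)"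
  shows "gen_inverse I J (\<lambda>i j. ev c (B i j)) (\<lambda>j i. ev c (G j i))"
  unfolding gen_inverse_def
proof (intro ballI)
  fix i j assume ij: "i \<in> I" "j \<in> J"
  then have "ev c (B i j) = ev c (\<Sum>j'\<in>J. \<Sum>i'\<in>I. B i j' * G j' i' * B i' j)"
    using assms(1) by (simp add: gen_inverse_def)
  also have "\<dots> = (\<Sum>j'\<in>J. \<Sum>i'\<in>I. ev c (B i j') * ev c (G j' i') * ev c (B i' j))"
    using ij by (simp add: ev_sum regular_sum ev_mult regular_mult reg)
  finally show "(\<Sum>j'\<in>J. \<Sum>i'\<in>I. ev c (B i j') * ev c (G j' i') * ev c (B i' j)) = ev c (B i j)" ..
qed

lemma ev_defect:
  assumes reg: "\<And>i j. i \<in> I \<Longrightarrow> j \<in> J \<Longrightarrow> regular c (B i j)" "\<And>i j. i \<in> I \<Longrightarrow> j \<in> J \<Longrightarrow> regular c (G j i)"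
    "\<And>l j. l \<in> L \<Longrightarrow> j \<in> J \<Longrightarrow> regular c (C l j)"
    "\<And>l m. l \<in> L \<Longrightarrow> m \<in> M \<Longrightarrow> regular c (E l m)" "\<And>l m. l \<in> L \<Longrightarrow> m \<in> M \<Longrightarrow> regular c (H m l)"
    and lj: "l \<in> L" "j \<in> J"
  shows "ev c (defect I J L M B C E G H l j) = defect I J L M (\<lambda>i j. ev c (B i j))
    (\<lambda>l j. ev c (C l j)) (\<lambda>l m. ev c (E l m)) (\<lambda>j i. ev c (G j i)) (\<lambda>m l. ev c (H m l)) l j"
proof -
  have E: "regular c ((if l = l' then 1 else 0) - (\<Sum>m\<in>M. E l m * H m l'))"
    "ev c ((if l = l' then 1 else 0) - (\<Sum>m\<in>M. E l m * H m l'))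
      = (if l = l' then 1 else 0) - (\<Sum>m\<in>M. ev c (E l m) * ev c (H m l'))" if "l' \<in> L" for l'
    by (simp_all only: regular_if ev_if regular_diff ev_diff regular_sum ev_sum regular_mult ev_mult
        reg lj that cong: sum.cong)
  have B: "regular c ((if j' = j then 1 else 0) - (\<Sum>i\<in>I. G j' i * B i j))"
    "ev c ((if j' = j then 1 else 0) - (\<Sum>i\<in>I. G j' i * B i j))
      = (if j' = j then 1 else 0) - (\<Sum>i\<in>I. ev c (G j' i) * ev c (B i j))" if "j' \<in> J" for j'
    by (simp_all only: regular_if ev_if regular_diff ev_diff regular_sum ev_sum regular_mult ev_mult
        reg lj that cong: sum.cong)
  have C: "regular c (\<Sum>j'\<in>J. C l' j' * ((if j' = j then 1 else 0) - (\<Sum>i\<in>I. G j' i * B i j)))"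
    "ev c (\<Sum>j'\<in>J. C l' j' * ((if j' = j then 1 else 0) - (\<Sum>i\<in>I. G j' i * B i j)))
      = (\<Sum>j'\<in>J. ev c (C l' j') * ((if j' = j then 1 else 0) - (\<Sum>i\<in>I. ev c (G j' i) * ev c (B i j))))"
    if "l' \<in> L" for l'
    using that by (simp_all only: regular_sum ev_sum regular_mult ev_mult reg B cong: sum.cong)
  show ?thesis
    unfolding defect_def
    by (simp only: regular_sum ev_sum regular_mult ev_mult E C cong: sum.cong)
qed

lemma ker_in_im_ev:
  fixes B :: "'i \<Rightarrow> 'j \<Rightarrow> 'k::field poly fract"
  assumes fin: "finite I" "finite J" "finite L" "finite M"
  obtains X where "finite X"
    and "\<And>c. (\<And>q. q \<in> X \<Longrightarrow> regular c q) \<Longrightarrow> ker_in_im I J L M B C E \<longleftrightarrow>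
      ker_in_im I J L M (\<lambda>i j. ev c (B i j)) (\<lambda>l j. ev c (C l j)) (\<lambda>l m. ev c (E l m))"
proof -
  obtain G where G: "gen_inverse I J B G"
    using gen_inverse_exists fin by blast
  obtain H where H: "gen_inverse L M E H"
    using gen_inverse_exists fin by blast
  let ?Z = "defect I J L M B C E G H"
  \<comment> \<open>Regularity of \<open>B\<close>, \<open>G\<close>, \<open>C\<close>,
    \<open>E\<close>, \<open>H\<close> makes the defect commute with evaluation. The inverses of the
    defect entries keep nonzero entries nonzero; where an entry is 0, its inverse is 0 by convention
    and hence regular.\<close>
  define X where "X = entries I J B \<union> entries I J (\<lambda>i j. G j i) \<union> entries L J C
    \<union> entries L M E \<union> entries L M (\<lambda>l m. H m l) \<union> entries L J ?Z \<union> entries L J (\<lambda>l j. inverse (?Z l j))"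
  show thesis
  proof (rule that)
    show "finite X"
      using fin by (simp add: X_def finite_entries)
  next
    fix c assume X: "\<And>q. q \<in> X \<Longrightarrow> regular c q"
    have reg: "regular c (B i j)" "regular c (G j i)" if "i \<in> I" "j \<in> J" for i j
      using that entriesI [of i I j J "\<lambda>i j. G j i"] by (intro X; simp add: X_def entriesI)+
    have reg': "regular c (E l m)" "regular c (H m l)" if "l \<in> L" "m \<in> M" for l m
      using that entriesI [of l L m M "\<lambda>l m. H m l"] by (intro X; simp add: X_def entriesI)+
    have regC: "regular c (C l j)" "regular c (?Z l j)" "regular c (inverse (?Z l j))"
      if "l \<in> L" "j \<in> J" for l j
      using that entriesI [of l L j J "\<lambda>l j. inverse (?Z l j)"]
      by (intro X; simp add: X_def entriesI)+
    have "defect I J L M B C E G H l j = 0 \<longleftrightarrow> defect I J L M (\<lambda>i j. ev c (B i j))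
        (\<lambda>l j. ev c (C l j)) (\<lambda>l m. ev c (E l m)) (\<lambda>j i. ev c (G j i)) (\<lambda>m l. ev c (H m l)) l j = 0"
      if "l \<in> L" "j \<in> J" for l j
    proof -
      have "?Z l j = 0 \<longleftrightarrow> ev c (?Z l j) = 0"
        using ev_nonzero [OF _ regC(2,3) [OF that]] by auto
      also have "ev c (?Z l j) = defect I J L M (\<lambda>i j. ev c (B i j))
          (\<lambda>l j. ev c (C l j)) (\<lambda>l m. ev c (E l m)) (\<lambda>j i. ev c (G j i)) (\<lambda>m l. ev c (H m l)) l j"
        by (rule ev_defect [where I = I and J = J and L = L and M = M, OF reg regC(1) reg' that])
      finally show ?thesis .
    qed
    then have "(\<forall>l\<in>L. \<forall>j\<in>J. ?Z l j = 0) \<longleftrightarrow> (\<forall>l\<in>L. \<forall>j\<in>J. defect I J L M (\<lambda>i j. ev c (B i j))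
        (\<lambda>l j. ev c (C l j)) (\<lambda>l m. ev c (E l m)) (\<lambda>j i. ev c (G j i)) (\<lambda>m l. ev c (H m l)) l j = 0)"
      by simp
    also have "\<dots> \<longleftrightarrow>
        ker_in_im I J L M (\<lambda>i j. ev c (B i j)) (\<lambda>l j. ev c (C l j)) (\<lambda>l m. ev c (E l m))"
      by (rule ker_in_im_iff_defect [OF fin gen_inverse_ev [OF G reg]
          gen_inverse_ev [OF H reg'], symmetric])
    finally show "ker_in_im I J L M B C E \<longleftrightarrow>
        ker_in_im I J L M (\<lambda>i j. ev c (B i j)) (\<lambda>l j. ev c (C l j)) (\<lambda>l m. ev c (E l m))"
      by (simp only: ker_in_im_iff_defect [OF fin G H])
  qed
qed

subsection \<open>Specialization of free resolutions and Ext\<close>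

text \<open>Over the field the columns of \<open>1 - G B\<close>, for
  \<open>B = scalar_mat D\<close>, span the kernel. Read back as vectors over the algebra they span
  the kernel of \<open>D\<close> with scalar coefficients, all the more with coefficients in the
  algebra.\<close>

lemma (in based_algebra) kernel_generators:
  fixes D :: "nat \<Rightarrow> nat \<Rightarrow> 'a"
  obtains m D' where "\<And>i l. i < n \<Longrightarrow> l < m \<Longrightarrow> mmul k D D' i l = 0"
    and "\<And>v. (\<And>i. i < n \<Longrightarrow> (\<Sum>l<k. D i l * v l) = 0) \<Longrightarrow> in_colspan k m D' v"
proof -
  let ?I = "{..<n} \<times> {..<d}" and ?J = "{..<k} \<times> {..<d}"
  have fin: "finite ?I" "finite ?J"
    by auto
  obtain G where G: "gen_inverse ?I ?J (scalar_mat D) G"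
    using gen_inverse_exists [OF fin] by blast
  define Q where "Q p q = (if p = q then 1 else 0) - (\<Sum>i\<in>?I. G p i * scalar_mat D i q)" for p q
  \<comment> \<open>Columns of a matrix must be numbered by an initial segment of the naturals, so
    the pairs in \<open>?J\<close> are enumerated.\<close>
  obtain \<beta> where \<beta>: "bij_betw \<beta> {..<card ?J} ?J"
    using ex_bij_betw_nat_finite [OF fin(2)] by (auto simp: atLeast0LessThan)
  define D' where "D' j l = (\<Sum>t<d. h (Q (j, t) (\<beta> l)) * e t)" for j l
  show thesis
  proof (rule that [of "card ?J" D'])
    fix i l assume il: "i < n" "l < card ?J"
    then have l: "\<beta> l \<in> ?J"
      using bij_betw_apply [OF \<beta>] by simp
    have "co (mmul k D D' i l) s = 0" if "s < d" for s
      using gen_inverse_mult_complement [OF fin(2) G _ l, of "(i, s)"] il that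
      by (simp add: mmul_def D'_def flip: Q_def scalar_mat_apply [where x = "\<lambda>p. Q p (\<beta> l)"])
    then show "mmul k D D' i l = 0"
      by (subst eq_iff_co) (simp add: co_zero)
  next
    fix v assume v: "\<And>i. i < n \<Longrightarrow> (\<Sum>l<k. D i l * v l) = 0"
    let ?x = "\<lambda>q. co (v (fst q)) (snd q)"
    have ker: "(\<Sum>q\<in>?J. scalar_mat D p q * ?x q) = 0" if "p \<in> ?I" for p
      using v that by (auto simp: scalar_mat_apply_co co_zero)
    have Qx: "(\<Sum>q\<in>?J. Q p q * ?x q) = ?x p" if "p \<in> ?J" for p
      unfolding Q_def by (subst sum_id_minus_mult [OF fin(2) that]) (simp add: ker)
    have "v j = (\<Sum>l<card ?J. D' j l * h (?x (\<beta> l)))" if "j < k" for j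
    proof -
      have "v j = (\<Sum>t<d. h (\<Sum>q\<in>?J. Q (j, t) q * ?x q) * e t)"
      proof -
        have "(\<Sum>q\<in>?J. Q (j, t) q * ?x q) = co (v j) t" if "t < d" for t
          using Qx [of "(j, t)"] \<open>j < k\<close> that by simp
        then have "(\<Sum>t<d. h (\<Sum>q\<in>?J. Q (j, t) q * ?x q) * e t) = (\<Sum>t<d. h (co (v j) t) * e t)"
          by (intro sum.cong) auto
        then show ?thesis
          by (simp only: expand)
      qed
      also have "\<dots> = (\<Sum>t<d. \<Sum>q\<in>?J. h (Q (j, t) q) * e t * h (?x q))"
        by (simp only: is_ring_hom_sum [OF hom] h_mult sum_distrib_left sum_distrib_right mult_ac)
      also have "\<dots> = (\<Sum>q\<in>?J. \<Sum>t<d. h (Q (j, t) q) * e t * h (?x q))"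
        by (rule sum.swap)
      also have "\<dots> = (\<Sum>l<card ?J. \<Sum>t<d. h (Q (j, t) (\<beta> l)) * e t * h (?x (\<beta> l)))"
        by (rule sum.reindex_bij_betw [OF \<beta>, symmetric])
      finally show ?thesis
        by (simp only: D'_def sum_distrib_right)
    qed
    then show "in_colspan k (card ?J) D' v"
      unfolding in_colspan_def by (intro exI [of _ "\<lambda>l. h (?x (\<beta> l))"]) blast
  qed
qed

lemma (in based_algebra) free_resolution_exists:
  fixes D0 :: "nat \<Rightarrow> nat \<Rightarrow> 'a"
  obtains n D where "free_resolution n D" "n 0 = n0" "n 1 = n1" "D 0 = D0"
proof -
  \<comment> \<open>A state is \<open>(n j, n (Suc j), D j)\<close>; its successor must start with
    the rank at which this one ends.\<close>
  define Q :: "nat \<times> nat \<times> (nat \<Rightarrow> nat \<Rightarrow> 'a) \<Rightarrow> nat \<times> nat \<times> (nat \<Rightarrow> nat \<Rightarrow> 'a) \<Rightarrow> bool" where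
    "Q x y \<longleftrightarrow> (case x of (n, k, X) \<Rightarrow> case y of (k', m, X') \<Rightarrow> k' = k \<and>
      (\<forall>i<n. \<forall>l<m. mmul k X X' i l = 0) \<and>
      (\<forall>v. (\<forall>i<n. (\<Sum>l<k. X i l * v l) = 0) \<longrightarrow> in_colspan k m X' v))" for x y
  have "\<exists>F. \<forall>j. (j = 0 \<longrightarrow> F j = (n0, n1, D0)) \<and> Q (F j) (F (Suc j))"
  proof (rule dependent_nat_choice)
    fix x :: "nat \<times> nat \<times> (nat \<Rightarrow> nat \<Rightarrow> 'a)" and j :: nat
    obtain n k X where x: "x = (n, k, X)"
      by (cases x)
    obtain m X' where "\<And>i l. i < n \<Longrightarrow> l < m \<Longrightarrow> mmul k X X' i l = 0"
      and "\<And>v. (\<And>i. i < n \<Longrightarrow> (\<Sum>l<k. X i l * v l) = 0) \<Longrightarrow> in_colspan k m X' v"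
      by (rule kernel_generators [of n k X]) (rule that; blast)
    then show "\<exists>y. (Suc j = 0 \<longrightarrow> y = (n0, n1, D0)) \<and> Q x y"
      by (intro exI [of _ "(k, m, X')"]) (auto simp: Q_def x)
  qed simp
  then obtain F where F0: "F 0 = (n0, n1, D0)" and F: "\<And>j. Q (F j) (F (Suc j))"
    by auto
  define n where "n j = fst (F j)" for j
  define D where "D j = snd (snd (F j))" for j
  have F_eq: "F j = (n j, n (Suc j), D j)" for j
    using F [of j] by (auto simp: Q_def n_def D_def split: prod.splits)
  have "free_resolution n D"
    using F unfolding free_resolution_def F_eq Q_def by simp
  moreover have "n 0 = n0" "n 1 = n1" "D 0 = D0"
    using F0 F_eq [of 0] by auto
  ultimately show thesis
    by (rule that)
qed

section \<open>The partial specialization map from A to R\<close>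

locale kx_base_change =
  R: based_algebra \<iota> d b coR + A: based_algebra g d "\<lambda>t. f (b t)" coA
  for \<iota> :: "'k::field \<Rightarrow> 'r::comm_ring_1" and f :: "'r \<Rightarrow> 'a::comm_ring_1"
    and g :: "'k poly fract \<Rightarrow> 'a" and d b coR coA +
  assumes f_hom: "is_ring_hom f" and f_scalar: "f (\<iota> y) = g (const_kx y)"
begin

definition reg :: "'k \<Rightarrow> 'a \<Rightarrow> bool" where
  "reg c a \<longleftrightarrow> (\<forall>t<d. regular c (coA a t))"

text \<open>Substitution \<open>x := c\<close> in the coordinates. On elements satisfying
  \<open>reg c\<close> it is the ring homomorphism to \<open>R\<close> induced by evaluation on the
  local ring of \<open>k(x)\<close> at \<open>c\<close>; elsewhere it involves junk values of
  \<open>ev\<close>.\<close>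

definition sp :: "'k \<Rightarrow> 'a \<Rightarrow> 'r" where
  "sp c a = (\<Sum>t<d. \<iota> (ev c (coA a t)) * b t)"

lemma coR_sp: "t < d \<Longrightarrow> coR (sp c a) t = ev c (coA a t)"
  by (rule R.co_unique) (simp_all add: sp_def)

lemma coA_f: "t < d \<Longrightarrow> coA (f r) t = const_kx (coR r t)"
proof (rule A.co_unique)
  have "f r = f (\<Sum>t<d. \<iota> (coR r t) * b t)"
    by (simp add: R.expand)
  also have "\<dots> = (\<Sum>t<d. g (const_kx (coR r t)) * f (b t))"
    using f_hom by (simp add: is_ring_hom_sum [OF f_hom] is_ring_hom_def f_scalar)
  finally show "(\<Sum>t<d. g (const_kx (coR r t)) * f (b t)) = f r" ..
qed

lemma sp_f: "sp c (f r) = r"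
  by (subst R.eq_iff_co) (simp add: coR_sp coA_f)

lemma sp_0: "sp c 0 = 0" and sp_1: "sp c 1 = 1"
proof -
  show "sp c 1 = 1"
    using sp_f [of c 1] f_hom by (simp add: is_ring_hom_def)
  show "sp c 0 = 0"
    by (subst R.eq_iff_co) (simp add: coR_sp A.co_zero R.co_zero)
qed

lemma coA_mult_f: "s < d \<Longrightarrow> coA (a * f r) s = (\<Sum>t<d. coA a t * const_kx (coR (b t * r) s))"
proof -
  assume s: "s < d"
  have "a * f r = (\<Sum>t<d. g (coA a t) * f (b t)) * f r"
    by (simp only: A.expand)
  also have "\<dots> = (\<Sum>t<d. g (coA a t) * f (b t * r))"
    using f_hom by (simp add: sum_distrib_right mult.assoc is_ring_hom_def)
  finally show ?thesis
    using s by (simp add: A.co_lincomb coA_f)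
qed

text \<open>For \<open>r = b t\<close> this compares the entries of \<open>scalar_mat\<close> over
  \<open>A\<close>, evaluated at \<open>c\<close>, with those of the specialized matrix over
  \<open>R\<close>.\<close>

lemma
  assumes "reg c a" and "s < d"
  shows regular_coA_mult_f: "regular c (coA (a * f r) s)"
    and ev_coA_mult_f: "ev c (coA (a * f r) s) = coR (sp c a * r) s"
proof -
  have reg: "regular c (coA a t)" if "t < d" for t
    using assms that by (simp add: reg_def)
  show "regular c (coA (a * f r) s)"
    unfolding coA_mult_f [OF assms(2)] by (intro regular_sum regular_mult reg regular_const) simp
  have "sp c a * r = (\<Sum>t<d. \<iota> (ev c (coA a t)) * (b t * r))"
    by (simp add: sp_def sum_distrib_right mult.assoc)
  then show "ev c (coA (a * f r) s) = coR (sp c a * r) s"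
    unfolding coA_mult_f [OF assms(2)] using assms(2)
    by (subst ev_sum) (simp_all add: ev_mult regular_mult reg R.co_lincomb)
qed

text \<open>The structure constants of \<open>A\<close> in the basis \<open>f (b t)\<close> are
  those of \<open>R\<close>. They are constant functions, so products create no new poles and
  evaluation respects them.\<close>

lemma
  assumes "reg c a" and "reg c a'"
  shows reg_mult: "reg c (a * a')" and sp_mult: "sp c (a * a') = sp c a * sp c a'"
proof -
  have co: "coA (a * a') s = (\<Sum>t<d. coA a' t * coA (a * f (b t)) s)" if "s < d" for s
  proof -
    have "a * a' = a * (\<Sum>t<d. g (coA a' t) * f (b t))"
      by (simp only: A.expand)
    also have "\<dots> = (\<Sum>t<d. g (coA a' t) * (a * f (b t)))"
      by (simp add: sum_distrib_left mult.left_commute)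
    finally show ?thesis
      using that by (simp add: A.co_lincomb)
  qed
  have a': "regular c (coA a' t)" if "t < d" for t
    using assms that by (simp add: reg_def)
  show "reg c (a * a')"
    unfolding reg_def using assms(1)
    by (simp add: co) (intro allI impI regular_sum regular_mult a' regular_coA_mult_f; simp)
  have "sp c a * sp c a' = (\<Sum>t<d. \<iota> (ev c (coA a' t)) * (sp c a * b t))"
    unfolding sp_def [of c a'] by (simp add: sum_distrib_left mult.left_commute)
  then have "coR (sp c a * sp c a') s = ev c (coA (a * a') s)" if "s < d" for s
    unfolding co [OF that] using that assms(1)
    by (subst ev_sum) (simp_all add: ev_mult regular_mult a' regular_coA_mult_f ev_coA_mult_f R.co_lincomb)
  then show "sp c (a * a') = sp c a * sp c a'"
    by (subst R.eq_iff_co) (simp add: coR_sp)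
qed

lemma sp_sum:
  assumes "\<And>s. s \<in> S \<Longrightarrow> reg c (F s)"
  shows "sp c (\<Sum>s\<in>S. F s) = (\<Sum>s\<in>S. sp c (F s))"
proof -
  have "regular c (coA (F s) t)" if "s \<in> S" "t < d" for s t
    using assms that by (simp add: reg_def)
  then show ?thesis
    by (subst R.eq_iff_co) (simp add: coR_sp A.co_sum R.co_sum ev_sum)
qed

text \<open>Descend from \<open>A\<close> to \<open>k(x)\<close> by restriction of scalars,
  substitute \<open>x := c\<close>, and go back up from \<open>k\<close> to
  \<open>R\<close>.\<close>

lemma ker_in_im_sp:
  fixes B :: "'i \<Rightarrow> 'j \<Rightarrow> 'a"
  assumes fin: "finite I" "finite J" "finite L" "finite M"
  obtains X where "finite X"
    and "\<And>c. (\<And>q. q \<in> X \<Longrightarrow> regular c q) \<Longrightarrow> ker_in_im I J L M B C E \<longleftrightarrow>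
      ker_in_im I J L M (\<lambda>i j. sp c (B i j)) (\<lambda>l j. sp c (C l j)) (\<lambda>l m. sp c (E l m))"
proof -
  let ?I = "I \<times> {..<d}" and ?J = "J \<times> {..<d}" and ?L = "L \<times> {..<d}" and ?M = "M \<times> {..<d}"
  have "finite ?I" "finite ?J" "finite ?L" "finite ?M"
    using fin by auto
  then obtain X where X: "finite X" "\<And>c. (\<And>q. q \<in> X \<Longrightarrow> regular c q) \<Longrightarrow>
      ker_in_im ?I ?J ?L ?M (A.scalar_mat B) (A.scalar_mat C) (A.scalar_mat E) \<longleftrightarrow>
      ker_in_im ?I ?J ?L ?M (\<lambda>i j. ev c (A.scalar_mat B i j)) (\<lambda>l j. ev c (A.scalar_mat C l j))
        (\<lambda>l m. ev c (A.scalar_mat E l m))"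
    by (rule ker_in_im_ev [where B = "A.scalar_mat B" and C = "A.scalar_mat C" and E = "A.scalar_mat E"])
      (rule that; blast)
  define S where "S = entries I J B \<union> entries L J C \<union> entries L M E"
  let ?X = "\<Union>a\<in>S. coA a ` {..<d}"
  show thesis
  proof (rule that [of "X \<union> ?X"])
    show "finite (X \<union> ?X)"
      using X(1) fin by (simp add: S_def finite_entries)
  next
    fix c assume *: "\<And>q. q \<in> X \<union> ?X \<Longrightarrow> regular c q"
    have "reg c a" if "a \<in> S" for a
      unfolding reg_def
    proof (intro allI impI *)
      fix t assume "t < d"
      with that show "coA a t \<in> X \<union> ?X"
        by (intro UnI2 UN_I [of a]) auto
    qed
    then have reg: "\<And>i j. i \<in> I \<Longrightarrow> j \<in> J \<Longrightarrow> reg c (B i j)"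
      "\<And>l j. l \<in> L \<Longrightarrow> j \<in> J \<Longrightarrow> reg c (C l j)" "\<And>l m. l \<in> L \<Longrightarrow> m \<in> M \<Longrightarrow> reg c (E l m)"
      by (simp_all add: S_def entriesI)
    have "ker_in_im I J L M B C E \<longleftrightarrow>
        ker_in_im ?I ?J ?L ?M (\<lambda>i j. ev c (A.scalar_mat B i j)) (\<lambda>l j. ev c (A.scalar_mat C l j))
        (\<lambda>l m. ev c (A.scalar_mat E l m))"
      using * by (subst A.ker_in_im_scalar_mat, intro X(2)) blast
    also have "\<dots> \<longleftrightarrow> ker_in_im ?I ?J ?L ?M (R.scalar_mat (\<lambda>i j. sp c (B i j)))
        (R.scalar_mat (\<lambda>l j. sp c (C l j))) (R.scalar_mat (\<lambda>l m. sp c (E l m)))"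
      by (rule ker_in_im_cong)
        (auto simp: A.scalar_mat_def R.scalar_mat_def ev_coA_mult_f reg)
    also have "\<dots> \<longleftrightarrow>
        ker_in_im I J L M (\<lambda>i j. sp c (B i j)) (\<lambda>l j. sp c (C l j)) (\<lambda>l m. sp c (E l m))"
      by (rule R.ker_in_im_scalar_mat [symmetric])
    finally show "ker_in_im I J L M B C E \<longleftrightarrow>
        ker_in_im I J L M (\<lambda>i j. sp c (B i j)) (\<lambda>l j. sp c (C l j)) (\<lambda>l m. sp c (E l m))" .
  qed
qed

end

section \<open>Cokernels, exactness and Ext as kernel-image inclusions\<close>

lemma sum_idm: "(\<Sum>j<p. idm l j * u j) = u l" if "l < p"
  using mmul_idm_left [OF that, of "\<lambda>i j. u i"] by (simp add: mmul_def)

text \<open>With an empty set of rows every vector lies in the kernel, so the inclusion says that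
  \<open>P\<close> is surjective.\<close>

lemma coker_nonzero_iff_ker_in_im:
  "coker_nonzero p q P \<longleftrightarrow> \<not> ker_in_im {} {..<p} {..<p} {..<q} P idm P"
  by (simp add: coker_nonzero_def ker_in_im_def in_colspan_def sum_idm Ball_def)

text \<open>The complex condition is kept apart from exactness: being an equation, it passes through
  \<open>sp\<close> directly.\<close>

lemma free_resolution_iff_ker_in_im:
  "free_resolution n D \<longleftrightarrow>
    (\<forall>j. \<forall>i<n j. \<forall>l<n (Suc (Suc j)). mmul (n (Suc j)) (D j) (D (Suc j)) i l = 0) \<and>
    (\<forall>j. ker_in_im {..<n j} {..<n (Suc j)} {..<n (Suc j)} {..<n (Suc (Suc j))} (D j) idm (D (Suc j)))"
  by (simp add: free_resolution_def ker_in_im_def in_colspan_def sum_idm Ball_def)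

text \<open>The matrix of the map \<open>(Y, W) \<mapsto> Y X + P W\<close>.\<close>

definition mult_plus :: "(nat \<Rightarrow> nat \<Rightarrow> 'a::comm_ring_1) \<Rightarrow> (nat \<Rightarrow> nat \<Rightarrow> 'a) \<Rightarrow>
    nat \<times> nat \<Rightarrow> nat \<times> nat + nat \<times> nat \<Rightarrow> 'a" where
  "mult_plus X P p z = (case z of
     Inl y \<Rightarrow> if fst p = fst y then X (snd y) (snd p) else 0
   | Inr y \<Rightarrow> if snd p = snd y then P (fst p) (fst y) else 0)"

lemma sum_mult_plus:
  fixes X :: "nat \<Rightarrow> nat \<Rightarrow> 'a::comm_ring_1"
  assumes "r < p" and "l < m"
  shows "(\<Sum>z\<in>({..<p} \<times> {..<n}) <+> ({..<q} \<times> {..<m}). mult_plus X P (r, l) z * u z)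
    = mmul n (\<lambda>r t. u (Inl (r, t))) X r l + mmul q P (\<lambda>s l. u (Inr (s, l))) r l"
proof -
  have prod: "(\<Sum>y\<in>S \<times> T. F y) = (\<Sum>a\<in>S. \<Sum>b\<in>T. F (a, b))" for S T :: "nat set" and F :: "nat \<times> nat \<Rightarrow> 'a"
    by (simp add: sum.cartesian_product)
  have "(\<Sum>y\<in>{..<p} \<times> {..<n}. mult_plus X P (r, l) (Inl y) * u (Inl y))
      = (\<Sum>r'<p. if r = r' then \<Sum>t<n. X t l * u (Inl (r', t)) else 0)"
    unfolding prod by (intro sum.cong) (auto simp: mult_plus_def)
  also have "\<dots> = mmul n (\<lambda>r t. u (Inl (r, t))) X r l"
    using assms by (simp add: mmul_def mult.commute)
  finally have 1: "(\<Sum>y\<in>{..<p} \<times> {..<n}. mult_plus X P (r, l) (Inl y) * u (Inl y)) = \<dots>" .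
  have 2: "(\<Sum>y\<in>{..<q} \<times> {..<m}. mult_plus X P (r, l) (Inr y) * u (Inr y))
      = mmul q P (\<lambda>s l. u (Inr (s, l))) r l"
    unfolding prod mmul_def using assms
    by (intro sum.cong) (simp_all add: mult_plus_def if_distrib [of "\<lambda>x. x * _"] cong: if_cong)
  show ?thesis
    by (simp add: sum.Plus 1 2)
qed

definition proj_Inl :: "'i \<Rightarrow> 'i + 'j \<Rightarrow> 'a::comm_ring_1" where
  "proj_Inl p z = (case z of Inl y \<Rightarrow> if p = y then 1 else 0 | Inr y \<Rightarrow> 0)"

lemma sum_proj_Inl:
  assumes "finite S" and "finite T" and "p \<in> S"
  shows "(\<Sum>z\<in>S <+> T. proj_Inl p z * u z) = u (Inl p)"
  using assms by (simp add: sum.Plus proj_Inl_def if_distrib [of "\<lambda>x. x * _"] cong: if_cong)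

text \<open>In degree \<open>0\<close> the inner dimension \<open>0\<close> kills the junk factor \<open>D (0 - 1) = D 0\<close>.\<close>

lemma ext_nonzero_res_cols_in:
  "ext_nonzero_res n D p q P i \<longleftrightarrow>
    (\<exists>Y. cols_in p q P (n (Suc i)) (mmul (n i) Y (D i)) \<and>
      \<not> (\<exists>Z. cols_in p q P (n i) (\<lambda>r m. Y r m - mmul (if i = 0 then 0 else n (i - 1)) Z (D (i - 1)) r m)))"
  by (cases i) (simp_all add: ext_nonzero_res_def cols_in_iff mmul_def [of 0])

text \<open>Absorbing the sign into \<open>W\<close> makes membership in the image a homogeneous
  equation, as a kernel requires.\<close>

lemma cols_in_iff_add:
  "cols_in p q P m X \<longleftrightarrow> (\<exists>W. \<forall>r<p. \<forall>l<m. X r l + mmul q P W r l = 0)"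
proof -
  have "mmul q P (\<lambda>i j. - W i j) r l = - mmul q P W r l" for W r l
    by (simp add: mmul_def sum_negf)
  then show ?thesis
    unfolding cols_in_def by (metis (no_types, lifting) add.inverse_inverse add_eq_0_iff)
qed

text \<open>As \<open>N\<close> is only a cokernel, "\<open>Y\<close> is a cocycle" is a congruence
  modulo the image of \<open>P\<close>. The extra unknown \<open>W\<close> turns it into the kernel
  of one matrix on pairs \<open>(Y, W)\<close>. Projecting to \<open>Y\<close> forgets
  \<open>W\<close>, and the coboundaries modulo \<open>P\<close> are the image of a matrix of the
  same shape.\<close>

lemma ext_nonzero_res_iff_ker_in_im:
  "ext_nonzero_res n D p q P i \<longleftrightarrow> \<not> ker_in_im ({..<p} \<times> {..<n (Suc i)})
    (({..<p} \<times> {..<n i}) <+> ({..<q} \<times> {..<n (Suc i)})) ({..<p} \<times> {..<n i})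
    (({..<p} \<times> {..<(if i = 0 then 0 else n (i - 1))}) <+> ({..<q} \<times> {..<n i}))
    (mult_plus (D i) P) proj_Inl (mult_plus (D (i - 1)) P)"
  (is "_ \<longleftrightarrow> \<not> ker_in_im ?I ?J ?L ?M _ _ _")
proof -
  define m where "m = (if i = 0 then 0 else n (i - 1))"
  let ?u = "\<lambda>Y W. case_sum (\<lambda>(r, t). Y r t) (\<lambda>(s, l). W s l)"
  have "ker_in_im ?I ?J ?L ?M (mult_plus (D i) P) proj_Inl (mult_plus (D (i - 1)) P) \<longleftrightarrow>
    (\<forall>u. (\<forall>r<p. \<forall>l<n (Suc i). mmul (n i) (\<lambda>r t. u (Inl (r, t))) (D i) r l
        + mmul q P (\<lambda>s l. u (Inr (s, l))) r l = 0) \<longrightarrow>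
      (\<exists>w. \<forall>r<p. \<forall>t<n i. u (Inl (r, t)) = mmul m (\<lambda>r t. w (Inl (r, t))) (D (i - 1)) r t
        + mmul q P (\<lambda>s t. w (Inr (s, t))) r t))"
    by (simp add: ker_in_im_def sum_mult_plus sum_proj_Inl Ball_def imp_conjL flip: m_def)
  also have "\<dots> \<longleftrightarrow> (\<forall>Y W. (\<forall>r<p. \<forall>l<n (Suc i). mmul (n i) Y (D i) r l + mmul q P W r l = 0) \<longrightarrow>
      (\<exists>Z W'. \<forall>r<p. \<forall>t<n i. Y r t = mmul m Z (D (i - 1)) r t + mmul q P W' r t))"
    (is "?lhs \<longleftrightarrow> ?rhs")
  proof
    assume l: ?lhs
    show ?rhs
    proof (intro allI impI)
      fix Y W
      assume "\<forall>r<p. \<forall>l<n (Suc i). mmul (n i) Y (D i) r l + mmul q P W r l = 0"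
      with l [THEN spec [of _ "?u Y W"]]
      show "\<exists>Z W'. \<forall>r<p. \<forall>t<n i. Y r t = mmul m Z (D (i - 1)) r t + mmul q P W' r t"
        by auto
    qed
  next
    assume r: ?rhs
    show ?lhs
    proof (intro allI impI)
      fix u
      assume "\<forall>r<p. \<forall>l<n (Suc i). mmul (n i) (\<lambda>r t. u (Inl (r, t))) (D i) r l
        + mmul q P (\<lambda>s l. u (Inr (s, l))) r l = 0"
      with r obtain Z W' where
        "\<forall>r<p. \<forall>t<n i. u (Inl (r, t)) = mmul m Z (D (i - 1)) r t + mmul q P W' r t"
        by blast
      then show "\<exists>w. \<forall>r<p. \<forall>t<n i. u (Inl (r, t)) = mmul m (\<lambda>r t. w (Inl (r, t))) (D (i - 1)) r t
          + mmul q P (\<lambda>s t. w (Inr (s, t))) r t"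
        by (intro exI [of _ "?u Z W'"]) simp
    qed
  qed
  also have "\<dots> \<longleftrightarrow> \<not> ext_nonzero_res n D p q P i"
    unfolding ext_nonzero_res_cols_in m_def [symmetric] cols_in_iff_add [of _ _ _ "n (Suc i)"]
    unfolding cols_in_def diff_eq_eq
    by (simp add: add.commute) blast
  finally show ?thesis
    unfolding m_def by blast
qed

text \<open>The place where uncountability of \<open>k\<close> enters.\<close>

lemma exists_regular:
  fixes X :: "'k::field poly fract set"
  assumes "uncountable (UNIV :: 'k set)" and "countable X"
  obtains c where "\<And>q. q \<in> X \<Longrightarrow> regular c q"
proof -
  have "{c. \<exists>q\<in>X. \<not> regular c q} \<noteq> UNIV"
    using countable_nonregular [OF assms(2)] assms(1) by metis
  then show thesis
    using that by blast
qed

section \<open>Specializing resolutions, cokernels and Ext groups at a common point\<close>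

context kx_base_change
begin

lemma sp_idm: "(\<lambda>i j. sp c (idm i j)) = idm"
  by (simp add: fun_eq_iff idm_def sp_0 sp_1)

lemma sp_proj_Inl: "(\<lambda>p z. sp c (proj_Inl p z)) = proj_Inl"
  by (simp add: fun_eq_iff proj_Inl_def sp_0 sp_1 split: sum.split)

lemma sp_mult_plus:
  "(\<lambda>p z. sp c (mult_plus X P p z)) = mult_plus (\<lambda>i j. sp c (X i j)) (\<lambda>i j. sp c (P i j))"
  by (simp add: fun_eq_iff mult_plus_def sp_0 split: sum.split)

lemma free_resolution_sp:
  assumes "free_resolution n D"
  obtains X where "countable X"
    and "\<And>c. (\<And>q. q \<in> X \<Longrightarrow> regular c q) \<Longrightarrow> free_resolution n (\<lambda>j i l. sp c (D j i l))"
proof -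
  have "\<exists>X. finite X \<and> (\<forall>c. (\<forall>q\<in>X. regular c q) \<longrightarrow>
      ker_in_im {..<n j} {..<n (Suc j)} {..<n (Suc j)} {..<n (Suc (Suc j))} (D j) idm (D (Suc j)) \<longrightarrow>
      ker_in_im {..<n j} {..<n (Suc j)} {..<n (Suc j)} {..<n (Suc (Suc j))}
        (\<lambda>i l. sp c (D j i l)) idm (\<lambda>i l. sp c (D (Suc j) i l)))" for j
    by (rule ker_in_im_sp [of "{..<n j}" "{..<n (Suc j)}" "{..<n (Suc j)}" "{..<n (Suc (Suc j))}"
          "D j" idm "D (Suc j)"]) (auto simp: sp_idm)
  then obtain X where X: "\<And>j. finite (X j)" "\<And>j c. (\<And>q. q \<in> X j \<Longrightarrow> regular c q) \<Longrightarrow>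
      ker_in_im {..<n j} {..<n (Suc j)} {..<n (Suc j)} {..<n (Suc (Suc j))} (D j) idm (D (Suc j)) \<Longrightarrow>
      ker_in_im {..<n j} {..<n (Suc j)} {..<n (Suc j)} {..<n (Suc (Suc j))}
        (\<lambda>i l. sp c (D j i l)) idm (\<lambda>i l. sp c (D (Suc j) i l))"
    by metis
  define S where "S j = entries {..<n j} {..<n (Suc j)} (D j)" for j
  \<comment> \<open>Besides the conditions for exactness, the coordinates of all entries of the
    differentials must be regular, for \<open>sp c\<close> to commute with their products.\<close>
  define Y where "Y = (\<Union>j. X j) \<union> (\<Union>j. \<Union>a\<in>S j. coA a ` {..<d})"
  show thesis
  proof (rule that)
    show "countable Y"
    proof -
      have "countable (\<Union>a\<in>S j. coA a ` {..<d})" for j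
        by (intro countable_finite) (simp add: S_def finite_entries)
      moreover have "countable (X j)" for j
        by (intro countable_finite X(1))
      ultimately show ?thesis
        unfolding Y_def by blast
    qed
  next
    fix c assume Y: "\<And>q. q \<in> Y \<Longrightarrow> regular c q"
    have reg: "reg c (D j i l)" if "i < n j" "l < n (Suc j)" for j i l
      unfolding reg_def
    proof (intro allI impI Y)
      fix t assume "t < d"
      moreover have "D j i l \<in> S j"
        using that by (simp add: S_def entriesI)
      ultimately show "coA (D j i l) t \<in> Y"
        unfolding Y_def by blast
    qed
    have "mmul (n (Suc j)) (\<lambda>i l. sp c (D j i l)) (\<lambda>i l. sp c (D (Suc j) i l)) i l = 0"
      if "i < n j" "l < n (Suc (Suc j))" for j i l
    proof -
      have "mmul (n (Suc j)) (\<lambda>i l. sp c (D j i l)) (\<lambda>i l. sp c (D (Suc j) i l)) i l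
          = sp c (mmul (n (Suc j)) (D j) (D (Suc j)) i l)"
        unfolding mmul_def using that by (subst sp_sum) (simp_all add: reg_mult sp_mult reg)
      then show ?thesis
        using free_resolution_comp [OF assms that] by (simp add: sp_0)
    qed
    moreover have "ker_in_im {..<n j} {..<n (Suc j)} {..<n (Suc j)} {..<n (Suc (Suc j))}
        (\<lambda>i l. sp c (D j i l)) idm (\<lambda>i l. sp c (D (Suc j) i l))" for j
      using assms unfolding free_resolution_iff_ker_in_im
      by (intro X(2) Y) (auto simp: Y_def)
    ultimately show "free_resolution n (\<lambda>j i l. sp c (D j i l))"
      unfolding free_resolution_iff_ker_in_im by blast
  qed
qed

lemma coker_nonzero_sp:
  obtains X where "countable X"
    and "\<And>c. (\<And>x. x \<in> X \<Longrightarrow> regular c x) \<Longrightarrow>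
      coker_nonzero p q P \<longleftrightarrow> coker_nonzero p q (\<lambda>i l. sp c (P i l))"
proof -
  have "finite ({} :: nat set)" "finite {..<p}" "finite {..<p}" "finite {..<q}"
    by auto
  then obtain X where "finite X" "\<And>c. (\<And>q. q \<in> X \<Longrightarrow> regular c q) \<Longrightarrow>
      ker_in_im ({} :: nat set) {..<p} {..<p} {..<q} P idm P \<longleftrightarrow> ker_in_im ({} :: nat set) {..<p} {..<p} {..<q}
        (\<lambda>i l. sp c (P i l)) (\<lambda>i l. sp c (idm i l)) (\<lambda>i l. sp c (P i l))"
    by (rule ker_in_im_sp [where B = P and C = idm and E = P]) (rule that; blast)
  then show thesis
    by (intro that [of X]) (auto simp: coker_nonzero_iff_ker_in_im sp_idm countable_finite)
qed

text \<open>Each degree contributes a finite set of conditions. Their union is countable and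
  independent of \<open>i\<close>, so one \<open>c\<close> serves all degrees.\<close>

lemma ext_nonzero_res_sp:
  obtains X where "countable X"
    and "\<And>c i. (\<And>x. x \<in> X \<Longrightarrow> regular c x) \<Longrightarrow> ext_nonzero_res n D p q P i \<longleftrightarrow>
      ext_nonzero_res n (\<lambda>j i l. sp c (D j i l)) p q (\<lambda>i l. sp c (P i l)) i"
proof -
  have "\<exists>X. finite X \<and> (\<forall>c. (\<forall>x\<in>X. regular c x) \<longrightarrow> (ext_nonzero_res n D p q P i \<longleftrightarrow>
      ext_nonzero_res n (\<lambda>j i l. sp c (D j i l)) p q (\<lambda>i l. sp c (P i l)) i))" for i
  proof -
    let ?I = "{..<p} \<times> {..<n (Suc i)}"
      and ?J = "({..<p} \<times> {..<n i}) <+> ({..<q} \<times> {..<n (Suc i)})" and ?L = "{..<p} \<times> {..<n i}"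
      and ?M = "({..<p} \<times> {..<(if i = 0 then 0 else n (i - 1))}) <+> ({..<q} \<times> {..<n i})"
    have "finite ?I" "finite ?J" "finite ?L" "finite ?M"
      by auto
    then obtain X where "finite X" "\<And>c. (\<And>x. x \<in> X \<Longrightarrow> regular c x) \<Longrightarrow>
        ker_in_im ?I ?J ?L ?M (mult_plus (D i) P) proj_Inl (mult_plus (D (i - 1)) P) \<longleftrightarrow>
        ker_in_im ?I ?J ?L ?M (\<lambda>y z. sp c (mult_plus (D i) P y z)) (\<lambda>y z. sp c (proj_Inl y z))
          (\<lambda>y z. sp c (mult_plus (D (i - 1)) P y z))"
      by (rule ker_in_im_sp [where B = "mult_plus (D i) P" and C = proj_Inl and E = "mult_plus (D (i - 1)) P"])
        (rule that; blast)
    then show ?thesis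
      unfolding ext_nonzero_res_iff_ker_in_im sp_mult_plus sp_proj_Inl by blast
  qed
  then obtain X where X: "\<And>i. finite (X i)" "\<And>i c. (\<And>x. x \<in> X i \<Longrightarrow> regular c x) \<Longrightarrow>
      ext_nonzero_res n D p q P i \<longleftrightarrow>
      ext_nonzero_res n (\<lambda>j i l. sp c (D j i l)) p q (\<lambda>i l. sp c (P i l)) i"
    by metis
  show thesis
  proof (rule that [of "\<Union>i. X i"])
    show "countable (\<Union>i. X i)"
      using X(1) by (auto intro: countable_finite)
  next
    fix c i assume "\<And>x. x \<in> (\<Union>i. X i) \<Longrightarrow> regular c x"
    then show "ext_nonzero_res n D p q P i \<longleftrightarrow>
        ext_nonzero_res n (\<lambda>j i l. sp c (D j i l)) p q (\<lambda>i l. sp c (P i l)) i"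
      by (intro X(2)) blast
  qed
qed

lemma ext_nonzero_sp:
  fixes D0 P :: "nat \<Rightarrow> nat \<Rightarrow> 'a"
  assumes "uncountable (UNIV :: 'k set)"
  obtains c where "coker_nonzero n0 n1 D0 \<longleftrightarrow> coker_nonzero n0 n1 (\<lambda>i l. sp c (D0 i l))"
    and "coker_nonzero p q P \<longleftrightarrow> coker_nonzero p q (\<lambda>i l. sp c (P i l))"
    and "\<And>i. ext_nonzero n0 n1 D0 p q P i \<longleftrightarrow>
      ext_nonzero n0 n1 (\<lambda>i l. sp c (D0 i l)) p q (\<lambda>i l. sp c (P i l)) i"
proof -
  obtain n D where res: "free_resolution n D" and D: "n 0 = n0" "n 1 = n1" "D 0 = D0"
    by (rule A.free_resolution_exists)
  obtain X1 where X1: "countable X1"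
    "\<And>c. (\<And>q. q \<in> X1 \<Longrightarrow> regular c q) \<Longrightarrow> free_resolution n (\<lambda>j i l. sp c (D j i l))"
    by (rule free_resolution_sp [OF res]) (rule that; blast)
  obtain X2 where X2: "countable X2" "\<And>c. (\<And>x. x \<in> X2 \<Longrightarrow> regular c x) \<Longrightarrow>
      coker_nonzero n0 n1 D0 \<longleftrightarrow> coker_nonzero n0 n1 (\<lambda>i l. sp c (D0 i l))"
    by (rule coker_nonzero_sp [of n0 n1 D0]) (rule that; blast)
  obtain X3 where X3: "countable X3" "\<And>c. (\<And>x. x \<in> X3 \<Longrightarrow> regular c x) \<Longrightarrow>
      coker_nonzero p q P \<longleftrightarrow> coker_nonzero p q (\<lambda>i l. sp c (P i l))"
    by (rule coker_nonzero_sp [of p q P]) (rule that; blast)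
  obtain X4 where X4: "countable X4" "\<And>c i. (\<And>x. x \<in> X4 \<Longrightarrow> regular c x) \<Longrightarrow>
      ext_nonzero_res n D p q P i \<longleftrightarrow>
      ext_nonzero_res n (\<lambda>j i l. sp c (D j i l)) p q (\<lambda>i l. sp c (P i l)) i"
    by (rule ext_nonzero_res_sp [of n D p q P]) (rule that; blast)
  have "countable (X1 \<union> X2 \<union> X3 \<union> X4)"
    using X1(1) X2(1) X3(1) X4(1) by simp
  then obtain c where c: "\<And>x. x \<in> X1 \<union> X2 \<union> X3 \<union> X4 \<Longrightarrow> regular c x"
    using exists_regular [OF assms] by blast
  \<comment> \<open>The specialized complex is again a resolution, so it computes Ext over
    \<open>R\<close>.\<close>
  have res': "free_resolution n (\<lambda>j i l. sp c (D j i l))"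
    by (intro X1(2) c) simp
  show thesis
  proof (rule that)
    show "coker_nonzero n0 n1 D0 \<longleftrightarrow> coker_nonzero n0 n1 (\<lambda>i l. sp c (D0 i l))"
      by (intro X2(2) c) simp
    show "coker_nonzero p q P \<longleftrightarrow> coker_nonzero p q (\<lambda>i l. sp c (P i l))"
      by (intro X3(2) c) simp
    show "ext_nonzero n0 n1 D0 p q P i \<longleftrightarrow>
        ext_nonzero n0 n1 (\<lambda>i l. sp c (D0 i l)) p q (\<lambda>i l. sp c (P i l)) i" for i
    proof -
      have "ext_nonzero n0 n1 D0 p q P i \<longleftrightarrow> ext_nonzero_res n D p q P i"
        using ext_nonzero_iff_res [OF res] D by simp
      also have "\<dots> \<longleftrightarrow> ext_nonzero_res n (\<lambda>j i l. sp c (D j i l)) p q (\<lambda>i l. sp c (P i l)) i"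
        by (intro X4(2) c) simp
      also have "\<dots> \<longleftrightarrow> ext_nonzero n0 n1 (\<lambda>i l. sp c (D0 i l)) p q (\<lambda>i l. sp c (P i l)) i"
        using ext_nonzero_iff_res [OF res'] D by simp
      finally show ?thesis .
    qed
  qed
qed

lemma ext_index_le:
  assumes "uncountable (UNIV :: 'k set)"
  shows "ext_index TYPE('a) \<le> ext_index TYPE('r)"
  unfolding ext_index_def
proof (intro Sup_subset_mono image_mono Collect_mono impI, elim exE conjE)
  fix i n0 n1 p q and D0 P :: "nat \<Rightarrow> nat \<Rightarrow> 'a"
  assume *: "coker_nonzero n0 n1 D0" "coker_nonzero p q P" "ext_nonzero n0 n1 D0 p q P i"
    "finite {j. ext_nonzero n0 n1 D0 p q P j}"
  obtain c where "coker_nonzero n0 n1 D0 \<longleftrightarrow> coker_nonzero n0 n1 (\<lambda>i l. sp c (D0 i l))"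
    "coker_nonzero p q P \<longleftrightarrow> coker_nonzero p q (\<lambda>i l. sp c (P i l))"
    "\<And>i. ext_nonzero n0 n1 D0 p q P i \<longleftrightarrow>
      ext_nonzero n0 n1 (\<lambda>i l. sp c (D0 i l)) p q (\<lambda>i l. sp c (P i l)) i"
    by (rule ext_nonzero_sp [OF assms, of n0 n1 D0 p q P]) (rule that; blast)
  with * show "\<exists>n0 n1 (D0 :: nat \<Rightarrow> nat \<Rightarrow> 'r) p q P. coker_nonzero n0 n1 D0 \<and> coker_nonzero p q P \<and>
      ext_nonzero n0 n1 D0 p q P i \<and> finite {j. ext_nonzero n0 n1 D0 p q P j}"
    by (intro exI [of _ n0] exI [of _ n1] exI [of _ "\<lambda>i l. sp c (D0 i l)"] exI [of _ p] exI [of _ q]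
        exI [of _ "\<lambda>i l. sp c (P i l)"]) simp
qed

end

lemma based_algebra_exists:
  fixes h :: "'f::field \<Rightarrow> 'a::comm_ring_1"
  assumes hom: "is_ring_hom h"
    and basis: "\<And>a. \<exists>!cs. length cs = d \<and> a = (\<Sum>t<d. h (cs ! t) * e t)"
  obtains co where "based_algebra h d e co"
proof -
  obtain F where F: "\<And>a. length (F a) = d" "\<And>a. (\<Sum>t<d. h (F a ! t) * e t) = a"
    using basis by metis
  have "based_algebra h d e (\<lambda>a t. F a ! t)"
  proof
    fix x a t
    assume x: "(\<Sum>t<d. h (x t) * e t) = a" and t: "t < d"
    \<comment> \<open>Uniqueness is assumed for lists of length \<open>d\<close>, so the coefficient
      function is first cut down to such a list.\<close>
    have x': "length (map x [0..<d]) = d \<and> a = (\<Sum>t<d. h (map x [0..<d] ! t) * e t)"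
      using x by simp
    have F': "length (F a) = d \<and> a = (\<Sum>t<d. h (F a ! t) * e t)"
      by (simp add: F)
    obtain unique: "\<forall>cs cs'. (length cs = d \<and> a = (\<Sum>t<d. h (cs ! t) * e t)) \<and>
        (length cs' = d \<and> a = (\<Sum>t<d. h (cs' ! t) * e t)) \<longrightarrow> cs = cs'"
      using basis [of a] by (rule alt_ex1E)
    have "F a = map x [0..<d]"
      by (rule unique [THEN spec, THEN spec, THEN mp, OF conjI [OF F' x']])
    with t show "F a ! t = x t"
      by simp
  qed (use hom F in auto)
  then show thesis ..
qed

theorem theorem4p2:
  fixes \<iota> :: "'k::field \<Rightarrow> 'r::comm_ring_1"
    and f :: "'r \<Rightarrow> 'a::comm_ring_1"
    and g :: "'k poly fract \<Rightarrow> 'a"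
  assumes "uncountable (UNIV :: 'k set)"
    and "finite_dim_algebra \<iota>"
    and "ext_index TYPE('r) < \<infinity>"
    and "is_base_change_kx \<iota> f g"
  shows "ext_index TYPE('a) < \<infinity> \<and> ext_index TYPE('a) \<le> ext_index TYPE('r)"
proof -
  \<comment> \<open>The basis comes from \<open>is_base_change_kx\<close>, because the same
    \<open>b\<close> has to give coordinates over \<open>k\<close> and, through \<open>f\<close>,
    over \<open>k(x)\<close>.\<close>
  obtain b where f: "is_ring_hom f" "\<And>y. f (\<iota> y) = g (const_kx y)" and g: "is_ring_hom g"
    and basisR: "is_k_basis \<iota> b"
    and basisA: "\<And>a. \<exists>!cs. length cs = length b \<and> a = (\<Sum>i<length b. g (cs ! i) * f (b ! i))"
    using assms(4) by (auto simp: is_base_change_kx_def)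
  have \<iota>: "is_ring_hom \<iota>"
    using assms(2) by (simp add: finite_dim_algebra_def)
  obtain coR where "based_algebra \<iota> (length b) ((!) b) coR"
    using based_algebra_exists [OF \<iota>, of "length b" "(!) b"] basisR by (auto simp: is_k_basis_def)
  moreover obtain coA where "based_algebra g (length b) (\<lambda>t. f (b ! t)) coA"
    using based_algebra_exists [OF g basisA] by blast
  ultimately interpret kx_base_change \<iota> f g "length b" "(!) b" coR coA
    by (simp add: kx_base_change_def kx_base_change_axioms_def f)
  have "ext_index TYPE('a) \<le> ext_index TYPE('r)"
    by (rule ext_index_le [OF assms(1)])
  with assms(3) show ?thesis
    using order.strict_trans1 by blast
qed

end
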